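(* Let $w\in W$ be a non-spiral element of the affine Weyl group $W$ of type $\tilde A_2$. Then the set $\{x\in W \mid x\le w\}$ (Bruhat order) equals the set of those $x\in W$ whose alcove centers $xq$ lie on or inside the hexagon $\mathcal H_w$.
   Context: Let $V\cong\mathbb R^2$ be a Euclidean plane with inner product $(\cdot,\cdot)$, containing the root system $\Phi=\{\pm\alpha_1,\pm\alpha_2,\pm\tilde\alpha\}$ of type $A_2$, with simple roots $\alpha_1,\alpha_2$, highest root $\tilde\alpha=\alpha_1+\alpha_2$, and $(\alpha,\alpha)=2$ for all $\alpha\in\Phi$; draw it so that $\alpha_1,\alpha_2$ make angles $-\pi/6$ and $\pi/2$ with the positive $x$-axis. For $\alpha\in\Phi$, $k\in\mathbb Z$ let $H_{\alpha,k}=\{v\in V\mid(\alpha,v)=k\}$ (a root hyperplane) and let $s_{\alpha,k}$ be the orthogonal reflection in $H_{\alpha,k}$. $W$ is the group of affine transformations of $V$ generated by all $s_{\alpha,k}$, with simple reflections $s_1=s_{\alpha_1,0}$, $s_2=s_{\alpha_2,0}$, $s_0=s_{\tilde\alpha,1}$ and length function $\ell$. The reflections of $W$ are exactly the $s_{\alpha,k}$; the Bruhat order $\le$ is generated by $w<rw$ for reflections $r$ with $\ell(w)<\ell(rw)$. Alcoves are the connected components of the complement of all root hyperplanes; $A_0=\{v\mid (v,\alpha_1)>0,(v,\alpha_2)>0,(v,\tilde\alpha)<1\}$ is the fundamental alcove and $q$ its center. Elements $w\in W$ are identified with alcoves $wA_0$ and alcove centers $wq$. A fundamental root strip is a region $\{v\mid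 0\le(\alpha,v)\le1\}$ with $\alpha\in\{\alpha_1,\alpha_2,\tilde\alpha\}$. An element $w$ is spiral if $wA_0$ lies in a fundamental root strip. Chambers are the six connected components of the complement of the union of the three fundamental root strips; each chamber is bounded by two rays lying along root hyperplanes (its walls), and every non-spiral element lies in a unique chamber. Hexagon $\mathcal H_w$: let $w$ be non-spiral in chamber $\mathcal C$. Let $H_{\alpha,i}$ and $H_{\beta,j}$ be the root hyperplanes bounding $\mathcal C$, with $H_{\alpha,i}$ counterclockwise from $w$ and $H_{\beta,j}$ clockwise from $w$, and let $H_{\gamma,k}$ be the nearer of the two hyperplanes $H_{\gamma,0},H_{\gamma,1}$ to $w$, where $\{\alpha,\beta,\gamma\}=\{\alpha_1,\alpha_2,\tilde\alpha\}$ and $i,j,k\in\{0,1\}$. Then $\mathcal H_w$ is the closed convex hexagon whose vertices, labeled counterclockwise from $w$, are (the alcove centers of) $w_0=w$, $w_1=s_{\alpha,i}w$, $w_2=s_{\gamma,k}w_1$, $w_3=s_{\gamma,k}w$, $w_4=s_{\gamma,k}w_5$, $w_5=s_{\beta,j}w$. *)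

theory Defs
  imports
    "HOL-Analysis.Analysis"
    "HOL-Algebra.Bij"
    "HOL-Algebra.Generated_Groups"
begin

text \<open>The Euclidean plane \<open>V\<close> is the type \<^typ>\<open>complex\<close> with its real inner product \<open>\<bullet>\<close>.
  Elements of the affine Weyl group are functions \<^typ>\<open>complex \<Rightarrow> complex\<close>.\<close>

definition alpha1 :: complex where
  "alpha1 = sqrt 2 *\<^sub>R cis (- pi / 6)"

definition alpha2 :: complex where
  "alpha2 = sqrt 2 *\<^sub>R cis (pi / 2)"

definition alpha_tilde :: complex where
  "alpha_tilde = alpha1 + alpha2"

definition pos_roots :: "complex set" where
  "pos_roots = {alpha1, alpha2, alpha_tilde}"

definition roots :: "complex set" where
  "roots = pos_roots \<union> uminus ` pos_roots"

definition root_hyperplane :: "complex \<Rightarrow> int \<Rightarrow> complex set" where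
  "root_hyperplane a k = {v. a \<bullet> v = of_int k}"

definition aff_refl :: "complex \<Rightarrow> int \<Rightarrow> complex \<Rightarrow> complex" where
  "aff_refl a k v = v - (2 * (a \<bullet> v - of_int k) / (a \<bullet> a)) *\<^sub>R a"

definition reflections :: "(complex \<Rightarrow> complex) set" where
  "reflections = {aff_refl a k | a k. a \<in> roots}"

text \<open>\<^term>\<open>BijGroup UNIV\<close> is the group of all bijections of the plane under composition.\<close>

definition affine_weyl :: "(complex \<Rightarrow> complex) set" where
  "affine_weyl = generate (BijGroup UNIV) reflections"

definition simple_reflections :: "(complex \<Rightarrow> complex) set" where
  "simple_reflections = {aff_refl alpha1 0, aff_refl alpha2 0, aff_refl alpha_tilde 1}"

definition weyl_length :: "(complex \<Rightarrow> complex) \<Rightarrow> nat" where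
  "weyl_length w =
     (LEAST n. \<exists>ss. set ss \<subseteq> simple_reflections \<and> length ss = n \<and> foldr (\<circ>) ss id = w)"

definition bruhat_step :: "(complex \<Rightarrow> complex) rel" where
  "bruhat_step = {(u, r \<circ> u) | u r. u \<in> affine_weyl \<and> r \<in> reflections \<and>
                                    weyl_length u < weyl_length (r \<circ> u)}"

definition bruhat_le :: "(complex \<Rightarrow> complex) \<Rightarrow> (complex \<Rightarrow> complex) \<Rightarrow> bool" where
  "bruhat_le x w \<longleftrightarrow> (x, w) \<in> bruhat_step\<^sup>*"

definition fund_alcove :: "complex set" where
  "fund_alcove = {v. v \<bullet> alpha1 > 0 \<and> v \<bullet> alpha2 > 0 \<and> v \<bullet> alpha_tilde < 1}"

text \<open>The center of the open triangle \<^term>\<open>fund_alcove\<close> is the barycenter of its vertices, i.e. of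
  the extreme points of its closure.\<close>

definition alcove_center :: complex where
  "alcove_center = (let X = {v. v extreme_point_of (closure fund_alcove)} in (\<Sum>v\<in>X. v) /\<^sub>R real (card X))"

definition fund_strip :: "complex \<Rightarrow> complex set" where
  "fund_strip a = {v. 0 \<le> a \<bullet> v \<and> a \<bullet> v \<le> 1}"

definition spiral :: "(complex \<Rightarrow> complex) \<Rightarrow> bool" where
  "spiral w \<longleftrightarrow> (\<exists>a\<in>pos_roots. w ` fund_alcove \<subseteq> fund_strip a)"

definition chambers :: "complex set set" where
  "chambers = components (- (\<Union>a\<in>pos_roots. fund_strip a))"

text \<open>\<open>cross2 u v\<close> is positive iff \<open>v\<close> is reached from \<open>u\<close> by a counterclockwise rotation by an
  angle strictly between \<open>0\<close> and \<open>\<pi>\<close>.\<close>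

definition cross2 :: "complex \<Rightarrow> complex \<Rightarrow> real" where
  "cross2 u v = Re u * Im v - Im u * Re v"

text \<open>\<open>wall_ray C a i p d\<close>: the hyperplane \<open>H\<^sub>a\<^sub>,\<^sub>i\<close> bounds the chamber \<open>C\<close>, and the corresponding wall is
  the ray from \<open>p\<close> (the apex of \<open>C\<close>) in direction \<open>d\<close>. Viewed from the apex, that wall
  lies counterclockwise of a point \<open>x\<close> of \<open>C\<close> iff \<open>cross2 (x - p) d > 0\<close>, as the angle of \<open>C\<close> at
  its apex is less than \<open>\<pi>\<close>.\<close>

definition wall_ray :: "complex set \<Rightarrow> complex \<Rightarrow> int \<Rightarrow> complex \<Rightarrow> complex \<Rightarrow> bool" where
  "wall_ray C a i p d \<longleftrightarrow>
     d \<noteq> 0 \<and> frontier C \<inter> root_hyperplane a i = {p + t *\<^sub>R d | t. t \<ge> 0}"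

definition ccw_wall :: "complex set \<Rightarrow> complex \<Rightarrow> complex \<Rightarrow> int \<Rightarrow> bool" where
  "ccw_wall C x a i \<longleftrightarrow> (\<exists>p d. wall_ray C a i p d \<and> cross2 (x - p) d > 0)"

definition cw_wall :: "complex set \<Rightarrow> complex \<Rightarrow> complex \<Rightarrow> int \<Rightarrow> bool" where
  "cw_wall C x a i \<longleftrightarrow> (\<exists>p d. wall_ray C a i p d \<and> cross2 (x - p) d < 0)"

definition hexagon_data ::
  "(complex \<Rightarrow> complex) \<Rightarrow> complex \<Rightarrow> int \<Rightarrow> complex \<Rightarrow> int \<Rightarrow> complex \<Rightarrow> int \<Rightarrow> bool" where
  "hexagon_data w a i b j c k \<longleftrightarrow>
     {a, b, c} = pos_roots \<and> {i, j, k} \<subseteq> {0, 1} \<and>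
     (\<exists>C\<in>chambers. w ` fund_alcove \<subseteq> C \<and>
        ccw_wall C (w alcove_center) a i \<and> cw_wall C (w alcove_center) b j) \<and>
     infdist (w alcove_center) (root_hyperplane c k)
       < infdist (w alcove_center) (root_hyperplane c (1 - k))"

definition hexagon_vertices ::
  "(complex \<Rightarrow> complex) \<Rightarrow> complex \<Rightarrow> int \<Rightarrow> complex \<Rightarrow> int \<Rightarrow> complex \<Rightarrow> int \<Rightarrow> (complex \<Rightarrow> complex) list" where
  "hexagon_vertices w a i b j c k =
     (let w1 = aff_refl a i \<circ> w; w2 = aff_refl c k \<circ> w1; w3 = aff_refl c k \<circ> w;
          w5 = aff_refl b j \<circ> w; w4 = aff_refl c k \<circ> w5
      in [w, w1, w2, w3, w4, w5])"

text \<open>For non-spiral \<open>w\<close> in the affine Weyl group the parameters are uniquely determined by \<open>w\<close>,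
  so that the description below is proper.\<close>

definition hexagon :: "(complex \<Rightarrow> complex) \<Rightarrow> complex set" where
  "hexagon w = (THE P. \<exists>a i b j c k. hexagon_data w a i b j c k \<and>
     P = convex hull ((\<lambda>u. u alcove_center) ` set (hexagon_vertices w a i b j c k)))"

end

theory Submission
  imports Defs
begin

text \<open>In barycentric coordinates with respect to the fundamental alcove, an alcove is a triple of integers
  (the integer parts of its coordinates) with sum \<open>0\<close> or \<open>-1\<close>, and its length is the sum of their absolute
  values. The hexagon is described by six inequalities between differences of coordinates. Reflecting a point
  of the hexagon in a hyperplane that separates it from the fundamental alcove stays inside the hexagon, so the
  hexagon is a lower set. Conversely, every alcove of the hexagon other than \<open>w\<close> can be reflected to a longer
  one inside the hexagon, so iterating this climbs up to \<open>w\<close>.\<close>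

section \<open>Barycentric coordinates\<close>

text \<open>The definitions are not combinatorial: length is a minimum over words, chambers are
  connected components, walls are rays in a frontier, and the hexagon is a definite description.
  Most of the work translates these into integers. The sum of absolute values counts the hyperplanes
  separating an alcove from the fundamental one. Identifying it with word length needs an element to
  be determined by its alcove, so symmetries of the fundamental alcove must be excluded; a vertex
  type modulo 3 does this. Up to relabelling the coordinates there are only two kinds of chamber:
  the apex is a vertex of the fundamental alcove, or the mirror image of one in the opposite side.
  The Boolean \<open>pos\<close> records the kind. The three coordinates of an alcove center share
  one fractional part, so bounds on differences say the same about centers as about integer parts.
  This is the exact bridge from a real convex hull to integer triples. Reflections towards the
  fundamental alcove stay inside because every chord of the hexagon in the direction of a root has
  its midpoint in the strip of that root.\<close>

text \<open>Measuring the highest root from its wall of \<^term>\<open>fund_alcove\<close> turns the three positive roots into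
  barycentric coordinates: they sum to \<open>1\<close>, are positive exactly on \<^term>\<open>fund_alcove\<close>, and are permuted
  by the symmetries of that triangle. \<open>wall_index\<close> is the corresponding renumbering of the hyperplanes.\<close>

definition bary :: "complex \<Rightarrow> complex \<Rightarrow> real" where
  "bary a v = (if a = alpha_tilde then 1 - a \<bullet> v else a \<bullet> v)"

definition wall_index :: "complex \<Rightarrow> int \<Rightarrow> int" where
  "wall_index a k = (if a = alpha_tilde then 1 - k else k)"

lemma wall_index_invol [simp]: "wall_index a (wall_index a k) = k"
  by (simp add: wall_index_def)

text \<open>With this numbering the three simple reflections are uniformly those with
  \<open>k = 0\<close>.\<close>

definition bary_refl :: "complex \<Rightarrow> int \<Rightarrow> complex \<Rightarrow> complex" where
  "bary_refl a k = aff_refl a (wall_index a k)"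

lemma alpha1_eq: "alpha1 = Complex (sqrt 2 * (sqrt 3 / 2)) (- (sqrt 2 / 2))"
  by (simp add: alpha1_def cis.ctr cos_30 sin_30 complex_eq_iff)

lemma alpha2_eq: "alpha2 = Complex 0 (sqrt 2)"
  by (simp add: alpha2_def cis.ctr complex_eq_iff)

lemma inner_roots [simp]:
  "alpha1 \<bullet> alpha1 = 2" "alpha2 \<bullet> alpha2 = 2" "alpha1 \<bullet> alpha2 = -1" "alpha2 \<bullet> alpha1 = -1"
  by (simp_all add: alpha1_eq alpha2_eq inner_complex_def algebra_simps)

lemma roots_distinct [simp]:
  "alpha1 \<noteq> alpha2" "alpha1 \<noteq> alpha_tilde" "alpha2 \<noteq> alpha_tilde"
  "alpha2 \<noteq> alpha1" "alpha_tilde \<noteq> alpha1" "alpha_tilde \<noteq> alpha2"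
  using inner_roots by (auto simp: alpha_tilde_def alpha1_eq alpha2_eq complex_eq_iff)

lemma inner_alpha_tilde [simp]:
  "alpha_tilde \<bullet> v = alpha1 \<bullet> v + alpha2 \<bullet> v" "v \<bullet> alpha_tilde = v \<bullet> alpha1 + v \<bullet> alpha2"
  by (simp_all add: alpha_tilde_def inner_simps)

lemma bary_coord_simps [simp]:
  "bary alpha1 v = alpha1 \<bullet> v" "bary alpha2 v = alpha2 \<bullet> v" "bary alpha_tilde v = 1 - alpha1 \<bullet> v - alpha2 \<bullet> v"
  by (simp_all add: bary_def)

lemma inner_left_eqI:
  assumes "alpha1 \<bullet> u = alpha1 \<bullet> v" "alpha2 \<bullet> u = alpha2 \<bullet> v"
  shows "u = v"
  using assms by (auto simp: alpha1_eq alpha2_eq inner_complex_def complex_eq_iff)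

text \<open>The inner products with \<open>alpha1\<close> and \<open>alpha2\<close> form a linear
  map of determinant \<open>cross2 alpha1 alpha2 = sqrt 3\<close>.\<close>

lemma cross2_coords:
  "sqrt 3 * cross2 u v = (alpha1 \<bullet> u) * (alpha2 \<bullet> v) - (alpha2 \<bullet> u) * (alpha1 \<bullet> v)"
proof -
  have *: "sqrt 2 * (sqrt 2 * x) = 2 * x" for x :: real by (simp flip: mult.assoc)
  show ?thesis
    by (simp add: alpha1_eq alpha2_eq inner_complex_def cross2_def algebra_simps *)
qed

text \<open>Working with an arbitrary ordering of the positive roots takes the place of transport
  along the symmetries of the fundamental alcove. Of these, only the identity lies in
  \<open>affine_weyl\<close>.\<close>

definition root_triple :: "complex \<Rightarrow> complex \<Rightarrow> complex \<Rightarrow> bool" where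
  "root_triple a b c \<longleftrightarrow> {a, b, c} = pos_roots"

lemma root_triple_cases:
  assumes "root_triple a b c"
  obtains "a = alpha1" "b = alpha2" "c = alpha_tilde" | "a = alpha1" "b = alpha_tilde" "c = alpha2"
    | "a = alpha2" "b = alpha1" "c = alpha_tilde" | "a = alpha2" "b = alpha_tilde" "c = alpha1"
    | "a = alpha_tilde" "b = alpha1" "c = alpha2" | "a = alpha_tilde" "b = alpha2" "c = alpha1"
proof -
  have e: "{a, b, c} = {alpha1, alpha2, alpha_tilde}"
    using assms by (simp add: root_triple_def pos_roots_def)
  have m: "alpha1 \<in> {a, b, c}" "alpha2 \<in> {a, b, c}" "alpha_tilde \<in> {a, b, c}"
    unfolding e by auto
  have "a \<in> {alpha1, alpha2, alpha_tilde}" "b \<in> {alpha1, alpha2, alpha_tilde}" "c \<in> {alpha1, alpha2, alpha_tilde}"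
    using e by blast+
  then have "a = alpha1 \<and> b = alpha2 \<and> c = alpha_tilde \<or> a = alpha1 \<and> b = alpha_tilde \<and> c = alpha2
    \<or> a = alpha2 \<and> b = alpha1 \<and> c = alpha_tilde \<or> a = alpha2 \<and> b = alpha_tilde \<and> c = alpha1
    \<or> a = alpha_tilde \<and> b = alpha1 \<and> c = alpha2 \<or> a = alpha_tilde \<and> b = alpha2 \<and> c = alpha1"
    by (elim insertE; use m in simp)
  then show ?thesis using that by blast
qed

lemma root_triple_perm:
  assumes "root_triple a b c"
  shows "root_triple b a c" "root_triple a c b" "root_triple c b a" "root_triple b c a" "root_triple c a b"
  using assms by (auto simp: root_triple_def)

lemma root_triple_distinct:
  assumes "root_triple a b c"
  shows "a \<noteq> b" "a \<noteq> c" "b \<noteq> c"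
  by (rule root_triple_cases[OF assms]; simp)+

lemma root_triple_mem:
  assumes "root_triple a b c"
  shows "x \<in> pos_roots \<longleftrightarrow> x = a \<or> x = b \<or> x = c"
  using assms by (auto simp: root_triple_def)

lemma root_triple_std: "root_triple alpha1 alpha2 alpha_tilde"
  by (simp add: root_triple_def pos_roots_def)

lemma pos_roots_eq: "root_triple a b c \<Longrightarrow> pos_roots = {a, b, c}"
  by (simp add: root_triple_def)

lemma obtain_root_triple:
  assumes "a \<in> pos_roots"
  obtains b c where "root_triple a b c"
proof -
  note root_triple_std root_triple_perm[OF root_triple_std]
  then show ?thesis using assms that unfolding pos_roots_def by blast
qed

lemma bary_coord_sum:
  assumes "root_triple a b c"
  shows "bary a v + bary b v + bary c v = 1"
  by (rule root_triple_cases[OF assms]; simp)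

lemma inner_bary_refl:
  "alpha1 \<bullet> bary_refl alpha1 k v = 2 * of_int k - alpha1 \<bullet> v"
  "alpha2 \<bullet> bary_refl alpha1 k v = alpha2 \<bullet> v + alpha1 \<bullet> v - of_int k"
  "alpha1 \<bullet> bary_refl alpha2 k v = alpha1 \<bullet> v + alpha2 \<bullet> v - of_int k"
  "alpha2 \<bullet> bary_refl alpha2 k v = 2 * of_int k - alpha2 \<bullet> v"
  "alpha1 \<bullet> bary_refl alpha_tilde k v = 1 - of_int k - alpha2 \<bullet> v"
  "alpha2 \<bullet> bary_refl alpha_tilde k v = 1 - of_int k - alpha1 \<bullet> v"
  by (simp_all add: bary_refl_def wall_index_def aff_refl_def inner_diff_right field_simps)

lemma bary_coord_refl:
  assumes "root_triple a b c"
  shows "bary a (bary_refl a k v) = 2 * of_int k - bary a v"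
    and "bary b (bary_refl a k v) = 1 - of_int k - bary c v"
  by (rule root_triple_cases[OF assms]; simp add: inner_bary_refl)+

lemma bary_coord_eqI:
  assumes t: "root_triple a b c" and eq: "bary a u = bary a v" "bary b u = bary b v"
  shows "u = v"
proof (rule inner_left_eqI)
  have "bary c u = bary c v" using eq bary_coord_sum[OF t, of u] bary_coord_sum[OF t, of v] by linarith
  then show "alpha1 \<bullet> u = alpha1 \<bullet> v" "alpha2 \<bullet> u = alpha2 \<bullet> v"
    using eq by - (rule root_triple_cases[OF t]; simp)+
qed

lemma bary_coord_point_exists:
  assumes "root_triple a b c"
  obtains v where "bary a v = s" "bary b v = t"
proof -
  \<comment> \<open>The combination \<open>x\<close> times the first plus \<open>y\<close> times the
    second vector of the basis dual to \<open>alpha1\<close>, \<open>alpha2\<close>.\<close>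
  define pt where "pt x y = ((2*x+y)/3) *\<^sub>R alpha1 + ((x+2*y)/3) *\<^sub>R alpha2" for x y :: real
  have p: "bary alpha1 (pt x y) = x" "bary alpha2 (pt x y) = y" "bary alpha_tilde (pt x y) = 1 - x - y" for x y
    unfolding pt_def by (simp_all add: inner_add_right field_simps)
  note p' = p[unfolded bary_coord_simps]
  show ?thesis using that[of "pt s t"] that[of "pt s (1-s-t)"] that[of "pt t s"] that[of "pt (1-s-t) s"]
      that[of "pt t (1-s-t)"] that[of "pt (1-s-t) t"]
    by - (rule root_triple_cases[OF assms]; simp add: p')
qed

lemma bary_coord_affine: "bary a ((1 - t) *\<^sub>R u + t *\<^sub>R v) = (1 - t) * bary a u + t * bary a v"
  by (simp add: bary_def inner_simps algebra_simps)

text \<open>The sign of the factor is the cyclic orientation of the triple. Leaving it existential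
  postpones the choice between clockwise and counterclockwise to one case split in
  \<open>sector_walls_oriented\<close>.\<close>

lemma cross2_bary_coord:
  assumes "root_triple a b c"
  shows "\<exists>\<kappa>. \<kappa> \<noteq> 0 \<and> (\<forall>p x y. cross2 (x - p) (y - p) =
     \<kappa> * ((bary a x - bary a p) * (bary b y - bary b p) - (bary b x - bary b p) * (bary a y - bary a p)))" (is "\<exists>\<kappa>. _ \<and> ?P \<kappa>")
proof -
  have c: "cross2 u v = (1 / sqrt 3) * ((alpha1 \<bullet> u) * (alpha2 \<bullet> v) - (alpha2 \<bullet> u) * (alpha1 \<bullet> v))" for u v
    using cross2_coords[of u v] by (simp add: field_simps)
  have "?P (1 / sqrt 3) \<or> ?P (- (1 / sqrt 3))"
    by (rule root_triple_cases[OF assms]; (rule disjI1, simp add: c inner_diff_right algebra_simps; fail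
          | rule disjI2, simp add: c inner_diff_right algebra_simps; fail))
  moreover have "1 / sqrt 3 \<noteq> 0" "- (1 / sqrt 3) \<noteq> 0" by simp_all
  ultimately show ?thesis by blast
qed

lemma root_hyperplane_eq: "root_hyperplane a k = {v. bary a v = of_int (wall_index a k)}"
  by (auto simp: root_hyperplane_def bary_def wall_index_def simp del: inner_alpha_tilde)

lemma fund_strip_eq: "fund_strip a = {v. 0 \<le> bary a v \<and> bary a v \<le> 1}"
  by (auto simp: fund_strip_def bary_def)

lemma fund_alcove_eq:
  assumes "root_triple a b c"
  shows "fund_alcove = {v. bary a v > 0 \<and> bary b v > 0 \<and> bary c v > 0}"
  by (rule root_triple_cases[OF assms])
    (auto simp: fund_alcove_def inner_commute[of _ alpha1] inner_commute[of _ alpha2])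

lemma continuous_bary_coord [continuous_intros]: "continuous_on S (bary a)"
  by (cases "a = alpha_tilde") (auto simp: bary_def simp del: inner_alpha_tilde intro!: continuous_intros)

section \<open>Reflections and the group they generate\<close>

lemma aff_refl_uminus: "aff_refl (- a) k = aff_refl a (- k)"
proof
  fix v
  have "2 * (- a \<bullet> v - of_int k) / (- a \<bullet> - a) = - (2 * (a \<bullet> v - of_int (- k)) / (a \<bullet> a))"
    by (simp add: minus_divide_left algebra_simps)
  then show "aff_refl (- a) k v = aff_refl a (- k) v"
    unfolding aff_refl_def by simp
qed

lemma reflections_eq: "reflections = {bary_refl a k | a k. a \<in> pos_roots}"
proof (intro equalityI subsetI)
  fix r assume "r \<in> reflections"
  then obtain a k where r: "r = aff_refl a k" and "a \<in> pos_roots \<or> - a \<in> pos_roots"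
    by (auto simp: reflections_def roots_def)
  then obtain b l where b: "b \<in> pos_roots" "r = aff_refl b l"
  proof (elim disjE)
    assume "- a \<in> pos_roots"
    then show thesis
      using that[of "- a" "- k"] r aff_refl_uminus[of a "- k"] by simp
  qed (use that r in simp)
  then have "r = bary_refl b (wall_index b l)"
    by (simp add: bary_refl_def)
  with b show "r \<in> {bary_refl a k | a k. a \<in> pos_roots}" by blast
next
  fix r assume "r \<in> {bary_refl a k | a k. a \<in> pos_roots}"
  then show "r \<in> reflections" by (auto simp: reflections_def roots_def bary_refl_def)
qed

lemma simple_reflections_eq: "simple_reflections = {bary_refl a 0 | a. a \<in> pos_roots}"
proof -
  have "{bary_refl a 0 | a. a \<in> pos_roots} = (\<lambda>a. bary_refl a 0) ` pos_roots" by blast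
  then show ?thesis
    by (simp add: simple_reflections_def pos_roots_def bary_refl_def wall_index_def)
qed

lemma bary_refl_invol:
  assumes "a \<in> pos_roots"
  shows "bary_refl a k \<circ> bary_refl a k = id"
proof
  fix v
  obtain b c where t: "root_triple a b c" using assms by (rule obtain_root_triple)
  show "(bary_refl a k \<circ> bary_refl a k) v = id v"
    using bary_coord_refl[OF t] bary_coord_refl[OF root_triple_perm(2)[OF t]] by (intro bary_coord_eqI[OF t]) simp_all
qed

lemma bary_refl_Bij: "a \<in> pos_roots \<Longrightarrow> bary_refl a k \<in> Bij UNIV"
  using bary_refl_invol[of a k] o_bij unfolding Bij_def by auto

lemma mult_BijGroup_UNIV: "f \<in> Bij UNIV \<Longrightarrow> g \<in> Bij UNIV \<Longrightarrow> f \<otimes>\<^bsub>BijGroup UNIV\<^esub> g = f \<circ> g"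
  by (simp add: BijGroup_def compose_def fun_eq_iff)

lemma one_BijGroup_UNIV: "\<one>\<^bsub>BijGroup UNIV\<^esub> = id"
  by (simp add: BijGroup_def fun_eq_iff)

lemma carrier_BijGroup: "carrier (BijGroup S) = Bij S"
  by (simp add: BijGroup_def)

lemma inv_bary_refl:
  assumes "a \<in> pos_roots"
  shows "inv\<^bsub>BijGroup UNIV\<^esub> (bary_refl a k) = bary_refl a k"
proof (rule group.inv_equality[OF group_BijGroup])
  show "bary_refl a k \<otimes>\<^bsub>BijGroup UNIV\<^esub> bary_refl a k = \<one>\<^bsub>BijGroup UNIV\<^esub>"
    using assms by (simp add: mult_BijGroup_UNIV one_BijGroup_UNIV bary_refl_Bij bary_refl_invol)
qed (simp_all add: carrier_BijGroup bary_refl_Bij assms)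

lemma reflections_subset_carrier: "reflections \<subseteq> carrier (BijGroup UNIV)"
  by (auto simp: reflections_eq carrier_BijGroup bary_refl_Bij)

lemma affine_weyl_Bij: "w \<in> affine_weyl \<Longrightarrow> w \<in> Bij UNIV"
  using group.generate_incl[OF group_BijGroup reflections_subset_carrier]
  by (auto simp: affine_weyl_def carrier_BijGroup)

lemma id_affine_weyl: "id \<in> affine_weyl"
  using generate.one[of "BijGroup UNIV" reflections] by (simp add: affine_weyl_def one_BijGroup_UNIV)

lemma comp_affine_weyl: "f \<in> affine_weyl \<Longrightarrow> g \<in> affine_weyl \<Longrightarrow> f \<circ> g \<in> affine_weyl"
  using generate.eng[of f "BijGroup UNIV" reflections g]
  by (simp add: affine_weyl_def[symmetric] mult_BijGroup_UNIV affine_weyl_Bij)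

lemma bary_refl_affine_weyl: "a \<in> pos_roots \<Longrightarrow> bary_refl a k \<in> affine_weyl"
  unfolding affine_weyl_def by (rule generate.incl) (auto simp: reflections_eq)

lemma affine_weyl_inverse:
  assumes "f \<in> affine_weyl"
  obtains g where "g \<in> affine_weyl" "g \<circ> f = id"
proof -
  interpret G: group "BijGroup (UNIV :: complex set)" by (rule group_BijGroup)
  have c: "f \<in> carrier (BijGroup UNIV)" using assms affine_weyl_Bij carrier_BijGroup by blast
  let ?g = "inv\<^bsub>BijGroup UNIV\<^esub> f"
  have "?g \<in> affine_weyl"
    using G.generate_m_inv_closed[OF reflections_subset_carrier] assms by (simp add: affine_weyl_def)
  moreover have "?g \<circ> f = id"
    using G.l_inv[OF c] \<open>?g \<in> affine_weyl\<close> assms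
    by (simp add: one_BijGroup_UNIV mult_BijGroup_UNIV affine_weyl_Bij)
  ultimately show ?thesis by (rule that)
qed

lemma affine_weyl_induct [consumes 1, case_names id refl]:
  assumes "w \<in> affine_weyl" "P id"
    and step: "\<And>w a k. \<lbrakk>w \<in> affine_weyl; a \<in> pos_roots; P w\<rbrakk> \<Longrightarrow> P (bary_refl a k \<circ> w)"
  shows "P w"
proof -
  \<comment> \<open>The rule for \<open>generate\<close> multiplies two arbitrary elements, so the
    induction shows that left multiplication by \<open>g\<close> preserves \<open>P\<close>.
    Applying this to \<open>id\<close> gives the claim.\<close>
  have "\<forall>w \<in> affine_weyl. P w \<longrightarrow> P (g \<circ> w)" if "g \<in> generate (BijGroup UNIV) reflections" for g
    using that
  proof (induction rule: generate.induct)
    case (eng g h)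
    then have "g \<in> affine_weyl" "h \<in> affine_weyl" by (simp_all add: affine_weyl_def)
    moreover have "P (g \<circ> (h \<circ> w))" if "w \<in> affine_weyl" "P w" for w
      using eng.IH that comp_affine_weyl \<open>h \<in> affine_weyl\<close> by blast
    ultimately show ?case
      by (simp add: mult_BijGroup_UNIV affine_weyl_Bij comp_def)
  qed (auto simp: one_BijGroup_UNIV reflections_eq inv_bary_refl comp_def intro: step[unfolded comp_def])
  from this[of w] assms(1,2) id_affine_weyl show ?thesis
    by (auto simp: affine_weyl_def[symmetric])
qed

section \<open>Alcoves\<close>

lemma in_closure_segment:
  fixes v q :: "'a::real_normed_vector"
  assumes "\<And>t. 0 < t \<Longrightarrow> t < 1 \<Longrightarrow> (1 - t) *\<^sub>R v + t *\<^sub>R q \<in> S"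
  shows "v \<in> closure S"
proof -
  have "((\<lambda>t. (1 - t) *\<^sub>R v + t *\<^sub>R q) \<longlongrightarrow> (1 - 0) *\<^sub>R v + 0 *\<^sub>R q) (at_right 0)"
    by (intro tendsto_intros)
  moreover have "eventually (\<lambda>t. (1 - t) *\<^sub>R v + t *\<^sub>R q \<in> closure S) (at_right (0::real))"
    using assms closure_subset[of S] by (intro eventually_at_rightI[of 0 1]) auto
  ultimately have "(1 - 0) *\<^sub>R v + 0 *\<^sub>R q \<in> closure S"
    by (intro Lim_in_closed_set[OF closed_closure]) auto
  then show ?thesis by simp
qed

lemma convex_bary_coord: "convex S \<Longrightarrow> convex {v. bary a v \<in> S}"
  by (simp add: convex_alt bary_coord_affine)

lemma closed_bary_coord: "closed S \<Longrightarrow> closed {v. bary a v \<in> S}"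
  using closed_vimage[OF _ continuous_bary_coord[of UNIV a], of S] by (simp add: vimage_def)

lemma open_bary_coord: "open S \<Longrightarrow> open {v. bary a v \<in> S}"
  using open_vimage[OF _ continuous_bary_coord[of UNIV a], of S] by (simp add: vimage_def)

lemma closure_fund_alcove:
  assumes t: "root_triple a b c"
  shows "closure fund_alcove = {v. bary a v \<ge> 0 \<and> bary b v \<ge> 0 \<and> bary c v \<ge> 0}"
proof
  have e: "{v. bary x v \<ge> 0} = {v. bary x v \<in> {0..}}" for x by auto
  have "closed {v. bary a v \<ge> 0 \<and> bary b v \<ge> 0 \<and> bary c v \<ge> 0}"
    unfolding Collect_conj_eq e by (intro closed_Int closed_bary_coord closed_atLeast)
  then show "closure fund_alcove \<subseteq> {v. bary a v \<ge> 0 \<and> bary b v \<ge> 0 \<and> bary c v \<ge> 0}"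
    by (intro closure_minimal) (auto simp: fund_alcove_eq[OF t])
  show "{v. bary a v \<ge> 0 \<and> bary b v \<ge> 0 \<and> bary c v \<ge> 0} \<subseteq> closure fund_alcove"
  proof
    fix v assume v: "v \<in> {v. bary a v \<ge> 0 \<and> bary b v \<ge> 0 \<and> bary c v \<ge> 0}"
    obtain q where q: "bary a q = 1/3" "bary b q = 1/3" using bary_coord_point_exists[OF t] by metis
    then have "bary c q = 1/3" using bary_coord_sum[OF t, of q] by simp
    with v q show "v \<in> closure fund_alcove"
      by (intro in_closure_segment[of _ q]) (auto simp: fund_alcove_eq[OF t] bary_coord_affine intro!: add_nonneg_pos)
  qed
qed

lemma bary_coord_combination3:
  assumes "x + y + z = 1"
  shows "bary a (x *\<^sub>R p + y *\<^sub>R q + z *\<^sub>R r) = x * bary a p + y * bary a q + z * bary a r"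
proof -
  have "z = 1 - x - y" using assms by simp
  then show ?thesis by (simp add: bary_def inner_add_right algebra_simps)
qed

text \<open>The closed alcove is the triangle whose vertices \<open>p\<close>, \<open>q\<close>,
  \<open>r\<close> each have one coordinate \<open>1\<close> and two coordinates \<open>0\<close>.
  Each vertex is extreme because the other two lie on the line where its nonzero coordinate
  vanishes.\<close>

lemma bary_coord_alcove_center:
  assumes "x \<in> pos_roots"
  shows "bary x alcove_center = 1/3"
proof -
  obtain a b c where t: "root_triple a b c" using obtain_root_triple[OF assms] .
  obtain p where p: "bary a p = 1" "bary b p = 0" using bary_coord_point_exists[OF t] by metis
  obtain q where q: "bary a q = 0" "bary b q = 1" using bary_coord_point_exists[OF t] by metis
  obtain r where r: "bary a r = 0" "bary b r = 0" using bary_coord_point_exists[OF t] by metis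
  have c: "bary c p = 0" "bary c q = 0" "bary c r = 1"
    using bary_coord_sum[OF t, of p] bary_coord_sum[OF t, of q] bary_coord_sum[OF t, of r] p q r by simp_all
  have ne: "p \<noteq> q" "p \<noteq> r" "q \<noteq> r" using p q r by auto
  have "closure fund_alcove = convex hull {p, q, r}"
  proof (intro equalityI subsetI)
    fix v assume v: "v \<in> closure fund_alcove"
    have s: "bary a v + bary b v + bary c v = 1" by (rule bary_coord_sum[OF t])
    have "v = bary a v *\<^sub>R p + bary b v *\<^sub>R q + bary c v *\<^sub>R r"
      by (rule bary_coord_eqI[OF t]) (simp_all add: bary_coord_combination3[OF s] p q r)
    with v s show "v \<in> convex hull {p, q, r}"
      unfolding closure_fund_alcove[OF t] convex_hull_3 by blast
  qed (auto simp: convex_hull_3 closure_fund_alcove[OF t] bary_coord_combination3 p q r c)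
  moreover have "x extreme_point_of (convex hull {p, q, r}) \<longleftrightarrow> x \<in> {p, q, r}" for x
  proof (rule extreme_point_of_convex_hull_convex_independent)
    have *: "convex hull S \<subseteq> {v. bary y v \<in> {0}}" if "\<And>v. v \<in> S \<Longrightarrow> bary y v = 0" for S y
      using that by (intro hull_minimal convex_bary_coord) auto
    have h: "convex hull ({p, q, r} - {p}) \<subseteq> {v. bary a v \<in> {0}}"
      "convex hull ({p, q, r} - {q}) \<subseteq> {v. bary b v \<in> {0}}"
      "convex hull ({p, q, r} - {r}) \<subseteq> {v. bary c v \<in> {0}}"
      by (rule *; use p q r c in auto)+
    fix x assume "x \<in> {p, q, r}"
    then show "x \<notin> convex hull ({p, q, r} - {x})"
      using h p q c by auto
  qed simp
  ultimately have "{v. v extreme_point_of closure fund_alcove} = {p, q, r}" by auto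
  then have "alcove_center = (\<Sum>v\<in>{p, q, r}. v) /\<^sub>R real (card {p, q, r})"
    by (simp only: alcove_center_def Let_def)
  also have "\<dots> = (1/3) *\<^sub>R p + (1/3) *\<^sub>R q + (1/3) *\<^sub>R r"
    using ne by (simp add: algebra_simps)
  finally have e: "alcove_center = (1/3) *\<^sub>R p + (1/3) *\<^sub>R q + (1/3) *\<^sub>R r" .
  have "bary y alcove_center = 1/3 * bary y p + 1/3 * bary y q + 1/3 * bary y r" for y
    unfolding e by (rule bary_coord_combination3) simp
  with p q r c assms show ?thesis by (auto simp: root_triple_mem[OF t])
qed

definition alcove_floor :: "(complex \<Rightarrow> complex) \<Rightarrow> complex \<Rightarrow> int" where
  "alcove_floor w a = \<lfloor>bary a (w alcove_center)\<rfloor>"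

text \<open>A reflection replaces the common fractional part \<open>e\<close> of the three
  coordinates by \<open>1 - e\<close>, which exchanges the two orientations of alcoves.\<close>

lemma bary_coord_center_cases:
  assumes "w \<in> affine_weyl"
  shows "(\<forall>a\<in>pos_roots. bary a (w alcove_center) = of_int (alcove_floor w a) + 1/3) \<or>
         (\<forall>a\<in>pos_roots. bary a (w alcove_center) = of_int (alcove_floor w a) + 2/3)"
proof -
  have "\<exists>m :: complex \<Rightarrow> int. \<exists>e\<in>{1/3, 2/3}. \<forall>a\<in>pos_roots. bary a (w alcove_center) = of_int (m a) + e"
    using assms
  proof (induction rule: affine_weyl_induct)
    case id
    then show ?case by (intro exI[of _ "\<lambda>_. 0"]) (auto simp: bary_coord_alcove_center)
  next
    case (refl w a k)
    obtain b c where t: "root_triple a b c" using obtain_root_triple[OF refl(2)] .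
    obtain m e where e: "e \<in> {1/3, 2/3::real}"
      and m: "\<forall>a\<in>pos_roots. bary a (w alcove_center) = of_int (m a) + e"
      using refl.IH by blast
    let ?m = "m(a := 2 * k - 1 - m a, b := - k - m c, c := - k - m b)"
    have "\<forall>x\<in>pos_roots. bary x ((bary_refl a k \<circ> w) alcove_center) = of_int (?m x) + (1 - e)"
      using root_triple_distinct[OF t] m bary_coord_refl[OF t] bary_coord_refl[OF root_triple_perm(2)[OF t]]
      by (simp add: pos_roots_eq[OF t])
    then show ?case using e by (intro exI[of _ ?m] bexI[of _ "1 - e"]) auto
  qed
  then obtain m :: "complex \<Rightarrow> int" and e where e: "e = 1/3 \<or> e = 2/3"
    and m: "\<forall>a\<in>pos_roots. bary a (w alcove_center) = of_int (m a) + e" by blast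
  have "alcove_floor w a = m a" if "a \<in> pos_roots" for a
    using m that e unfolding alcove_floor_def floor_eq_iff by auto
  with e m show ?thesis by auto
qed

text \<open>The coordinates sum to \<open>1\<close>, so the floors sum to \<open>1 - 3 * e\<close>
  for the common fractional part \<open>e\<close>, which is \<open>1/3\<close> or
  \<open>2/3\<close>. Solving for \<open>e\<close> recovers the center from the floors.\<close>

lemma alcove_floor_sum:
  assumes "w \<in> affine_weyl" "root_triple a b c"
  shows "alcove_floor w a + alcove_floor w b + alcove_floor w c \<in> {0, -1}"
    and "bary a (w alcove_center) = of_int (alcove_floor w a)
           + (1 - of_int (alcove_floor w a + alcove_floor w b + alcove_floor w c)) / 3"
proof -
  have *: "x \<in> {0, -1} \<and> (1 - of_int x) / 3 = 1/3" if "of_int x = (0::real)" for x :: int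
    using that by simp
  have **: "x \<in> {0, -1} \<and> (1 - of_int x) / 3 = (2/3::real)" if "of_int x = (-1::real)" for x :: int
  proof -
    have "x = -1" using that by linarith
    then show ?thesis by simp
  qed
  let ?s = "alcove_floor w a + alcove_floor w b + alcove_floor w c"
  have s: "of_int ?s = (0::real) \<and> bary a (w alcove_center) = of_int (alcove_floor w a) + 1/3
    \<or> of_int ?s = (-1::real) \<and> bary a (w alcove_center) = of_int (alcove_floor w a) + 2/3"
    using bary_coord_center_cases[OF assms(1)] bary_coord_sum[OF assms(2), of "w alcove_center"]
    by (auto simp: root_triple_mem[OF assms(2)])
  show "?s \<in> {0, -1}" "bary a (w alcove_center) = of_int (alcove_floor w a) + (1 - of_int ?s) / 3"
    using s *[of ?s] **[of ?s] by metis+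
qed

lemma alcove_floor_refl:
  assumes "w \<in> affine_weyl" "root_triple a b c"
  shows "alcove_floor (bary_refl a k \<circ> w) a = 2 * k - 1 - alcove_floor w a"
    and "alcove_floor (bary_refl a k \<circ> w) b = - alcove_floor w c - k"
    and "alcove_floor (bary_refl a k \<circ> w) c = - alcove_floor w b - k"
proof -
  have *: "\<exists>e. 0 < e \<and> e < 1 \<and> (\<forall>a\<in>pos_roots. bary a (w alcove_center) = of_int (alcove_floor w a) + e)"
    using bary_coord_center_cases[OF assms(1)]
  proof
    assume "\<forall>a\<in>pos_roots. bary a (w alcove_center) = of_int (alcove_floor w a) + 1/3"
    then show ?thesis by (intro exI[of _ "1/3"]) auto
  next
    assume "\<forall>a\<in>pos_roots. bary a (w alcove_center) = of_int (alcove_floor w a) + 2/3"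
    then show ?thesis by (intro exI[of _ "2/3"]) auto
  qed
  then obtain e where "0 < e" "e < 1"
    and "\<forall>a\<in>pos_roots. bary a (w alcove_center) = of_int (alcove_floor w a) + e" by blast
  then show "alcove_floor (bary_refl a k \<circ> w) a = 2 * k - 1 - alcove_floor w a"
    "alcove_floor (bary_refl a k \<circ> w) b = - alcove_floor w c - k"
    "alcove_floor (bary_refl a k \<circ> w) c = - alcove_floor w b - k"
    unfolding alcove_floor_def[of "bary_refl a k \<circ> w"] floor_eq_iff
    using bary_coord_refl[OF assms(2)] bary_coord_refl[OF root_triple_perm(2)[OF assms(2)]]
    by (simp_all add: root_triple_mem[OF assms(2)])
qed

lemma image_fund_alcove:
  assumes "w \<in> affine_weyl"
  shows "w ` fund_alcove = {v. \<forall>a\<in>pos_roots. of_int (alcove_floor w a) < bary a v \<and> bary a v < of_int (alcove_floor w a) + 1}"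
  using assms
proof (induction rule: affine_weyl_induct)
  case id
  note t = root_triple_std
  have "alcove_floor id x = 0" if "x \<in> pos_roots" for x
    using that by (simp add: alcove_floor_def bary_coord_alcove_center)
  then have "v \<in> id ` fund_alcove \<longleftrightarrow> (\<forall>a\<in>pos_roots. of_int (alcove_floor id a) < bary a v \<and> bary a v < of_int (alcove_floor id a) + 1)" for v
    unfolding fund_alcove_eq[OF t] using bary_coord_sum[OF t, of v] by (auto simp: pos_roots_eq[OF t])
  then show ?case by blast
next
  case (refl w a k)
  obtain b c where t: "root_triple a b c" using obtain_root_triple[OF refl(2)] .
  have inv: "bary_refl a k (bary_refl a k v) = v" for v
    using bary_refl_invol[OF refl(2), of k] by (metis comp_apply id_apply)
  have "v \<in> (bary_refl a k \<circ> w) ` fund_alcove \<longleftrightarrow> bary_refl a k v \<in> w ` fund_alcove" for v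
    unfolding image_comp[symmetric] using inv by (metis (no_types, lifting) imageE imageI)
  then show ?case
    unfolding refl.IH set_eq_iff
    using alcove_floor_refl[OF refl(1) t, of k] bary_coord_refl[OF t, of k] bary_coord_refl[OF root_triple_perm(2)[OF t], of k]
      bary_coord_sum[OF t]
    by (simp add: pos_roots_eq[OF t]; smt (verit))
qed

section \<open>Length\<close>

text \<open>This separates the sign, the relabelling of roots and the integral shift of an element.
  Fixing the center will force sign \<open>1\<close> and shift \<open>0\<close>, so that only the
  relabelling remains to be excluded.\<close>

lemma affine_weyl_affine_form:
  assumes "w \<in> affine_weyl"
  shows "\<exists>e::real. \<exists>p. \<exists>c::complex \<Rightarrow> int. (e = 1 \<or> e = -1) \<and> (\<forall>x\<in>pos_roots. p x \<in> pos_roots \<and>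
           (\<forall>v. bary x (w v) = e * bary (p x) v + of_int (c x)))"
    using assms
  proof (induction rule: affine_weyl_induct)
    case id
    show ?case
      by (rule exI[of _ 1], rule exI[of _ id], rule exI[of _ "\<lambda>_. 0"]) simp
  next
    case (refl w a k)
    obtain b d where t: "root_triple a b d" using obtain_root_triple[OF refl(2)] .
    obtain e :: real and p and c :: "complex \<Rightarrow> int" where e: "e = 1 \<or> e = -1"
      and p: "\<And>x. x \<in> pos_roots \<Longrightarrow> p x \<in> pos_roots"
      and c: "\<And>x v. x \<in> pos_roots \<Longrightarrow> bary x (w v) = e * bary (p x) v + of_int (c x)"
      using refl.IH by blast
    have m: "a \<in> pos_roots" "b \<in> pos_roots" "d \<in> pos_roots" by (simp_all add: pos_roots_eq[OF t])
    show ?case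
      using root_triple_distinct[OF t] e p[OF m(1)] p[OF m(2)] p[OF m(3)] c[OF m(1)] c[OF m(2)] c[OF m(3)]
      by (intro exI[of _ "- e"] exI[of _ "p(b := p d, d := p b)"]
          exI[of _ "c(a := 2 * k - c a, b := 1 - k - c d, d := 1 - k - c b)"])
        (auto simp: pos_roots_eq[OF t] bary_coord_refl[OF t] bary_coord_refl[OF root_triple_perm(2)[OF t]])
  qed

text \<open>The vertices of the alcoves have integral coordinates, and \<^term>\<open>affine_weyl\<close> preserves their type
  \<open>(alpha1 \<bullet> v - alpha2 \<bullet> v) mod 3\<close>. This is what excludes the rotations of an alcove.\<close>

lemma affine_weyl_vertex_type:
  assumes "w \<in> affine_weyl" "alpha1 \<bullet> v = of_int m" "alpha2 \<bullet> v = of_int n"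
  shows "\<exists>m' n'. alpha1 \<bullet> w v = of_int m' \<and> alpha2 \<bullet> w v = of_int n' \<and> 3 dvd (m' - n') - (m - n)"
  using assms(1)
proof (induction rule: affine_weyl_induct)
  case (refl w a k)
  then obtain m' n' where w: "alpha1 \<bullet> w v = of_int m'" "alpha2 \<bullet> w v = of_int n'"
    and d: "3 dvd (m' - n') - (m - n)" by blast
  consider "a = alpha1" | "a = alpha2" | "a = alpha_tilde" using refl(2) by (auto simp: pos_roots_def)
  then show ?case
  proof cases
    case 1
    have "3 dvd ((2 * k - m') - (n' + m' - k)) - (m - n)" using d by presburger
    then show ?thesis using w
      by (intro exI[of _ "2 * k - m'"] exI[of _ "n' + m' - k"]) (simp add: 1 inner_bary_refl)
  next
    case 2
    have "3 dvd ((m' + n' - k) - (2 * k - n')) - (m - n)" using d by presburger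
    then show ?thesis using w
      by (intro exI[of _ "m' + n' - k"] exI[of _ "2 * k - n'"]) (simp add: 2 inner_bary_refl)
  next
    case 3
    have "3 dvd ((1 - k - n') - (1 - k - m')) - (m - n)" using d by presburger
    then show ?thesis using w
      by (intro exI[of _ "1 - k - n'"] exI[of _ "1 - k - m'"]) (simp add: 3 inner_bary_refl)
  qed
qed (use assms in auto)

text \<open>Sign \<open>-1\<close> would require an integer shift of \<open>2/3\<close>. What is
  left relabels coordinates, and the vertices of the fundamental alcove have pairwise different
  types modulo 3. Testing the vertices with \<open>(alpha1, alpha2)\<close> coordinates
  \<open>(1, 0)\<close> and \<open>(0, 1)\<close> therefore fixes the labels.\<close>

lemma affine_weyl_fix_center:
  assumes g: "g \<in> affine_weyl" and q: "g alcove_center = alcove_center"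
  shows "g = id"
proof -
  obtain e :: real and p and c :: "complex \<Rightarrow> int" where e: "e = 1 \<or> e = -1"
    and p: "\<And>x. x \<in> pos_roots \<Longrightarrow> p x \<in> pos_roots"
    and c: "\<And>x v. x \<in> pos_roots \<Longrightarrow> bary x (g v) = e * bary (p x) v + of_int (c x)"
    using affine_weyl_affine_form[OF g] by blast
  have eq: "bary x (g v) = bary (p x) v" if x: "x \<in> pos_roots" for x v
  proof -
    have *: "3 * of_int (c x) = 1 - e"
      using c[OF x, of alcove_center] by (simp add: q bary_coord_alcove_center x p)
    have "e = 1"
    proof (rule ccontr)
      assume "e \<noteq> 1"
      with e * have "real_of_int (3 * c x) = real_of_int 2" by simp
      then have "3 * c x = 2" using of_int_eq_iff by blast
      then show False by presburger
    qed
    with * c[OF x, of v] show ?thesis by simp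
  qed
  note eq1 = eq[of alpha1, unfolded bary_coord_simps] and eq2 = eq[of alpha2, unfolded bary_coord_simps]
  have P: "alpha1 \<in> pos_roots" "alpha2 \<in> pos_roots" by (simp_all add: pos_roots_def)
  have cases: "p x = alpha1 \<or> p x = alpha2 \<or> p x = alpha_tilde" if "x \<in> pos_roots" for x
    using p[OF that] by (auto simp: pos_roots_def)
  have i: "real_of_int m = 1 \<longleftrightarrow> m = 1" "real_of_int m = 0 \<longleftrightarrow> m = 0"
    "1 = real_of_int m \<longleftrightarrow> m = 1" "0 = real_of_int m \<longleftrightarrow> m = 0" for m by auto
  obtain v1 where v1: "alpha1 \<bullet> v1 = 1" "alpha2 \<bullet> v1 = 0"
    using bary_coord_point_exists[OF root_triple_std, of 1 0] by auto
  obtain m n :: int where mn: "alpha1 \<bullet> g v1 = of_int m" "alpha2 \<bullet> g v1 = of_int n" "3 dvd m - n - 1"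
    using affine_weyl_vertex_type[OF g, of v1 1 0] v1 by auto
  have "p alpha1 = alpha1"
    using mn cases[OF P(1)] cases[OF P(2)] eq1[OF P(1), of v1] eq2[OF P(2), of v1] v1
    by (elim disjE) (simp_all add: i)
  obtain v2 where v2: "alpha1 \<bullet> v2 = 0" "alpha2 \<bullet> v2 = 1"
    using bary_coord_point_exists[OF root_triple_std, of 0 1] by auto
  obtain m n :: int where mn: "alpha1 \<bullet> g v2 = of_int m" "alpha2 \<bullet> g v2 = of_int n" "3 dvd m - n + 1"
    using affine_weyl_vertex_type[OF g, of v2 0 1] v2 by auto
  have "p alpha2 = alpha2"
    using mn cases[OF P(1)] cases[OF P(2)] eq1[OF P(1), of v2] eq2[OF P(2), of v2] v2
    by (elim disjE) (simp_all add: i)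
  show ?thesis
  proof
    fix v show "g v = id v"
      using eq1[OF P(1), of v] eq2[OF P(2), of v] \<open>p alpha1 = alpha1\<close> \<open>p alpha2 = alpha2\<close>
      by (intro inner_left_eqI) simp_all
  qed
qed

lemma affine_weyl_eqI:
  assumes f: "f \<in> affine_weyl" and g: "g \<in> affine_weyl"
    and eq: "f alcove_center = g alcove_center"
  shows "f = g"
proof -
  obtain h where h: "h \<in> affine_weyl" "h \<circ> f = id" using affine_weyl_inverse[OF f] .
  have "(h \<circ> g) alcove_center = alcove_center" using h(2) eq by (metis comp_apply id_apply)
  then have "h \<circ> g = id" by (intro affine_weyl_fix_center comp_affine_weyl h g)
  moreover have "inj h"
    using affine_weyl_Bij[OF h(1)] by (auto simp: Bij_def bij_betw_def)
  ultimately show ?thesis using h(2) by (metis ext comp_apply injD)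
qed

lemma affine_weyl_eqI_floor:
  assumes "f \<in> affine_weyl" "g \<in> affine_weyl" "\<And>a. a \<in> pos_roots \<Longrightarrow> alcove_floor f a = alcove_floor g a"
  shows "f = g"
proof (rule affine_weyl_eqI[OF assms(1,2)])
  note t = root_triple_std and t' = root_triple_perm(1)[OF root_triple_std]
  show "f alcove_center = g alcove_center"
    using alcove_floor_sum(2)[OF assms(1) t] alcove_floor_sum(2)[OF assms(2) t]
      alcove_floor_sum(2)[OF assms(1) t'] alcove_floor_sum(2)[OF assms(2) t'] assms(3)
    by (intro bary_coord_eqI[OF t]) (simp_all add: pos_roots_eq[OF t])
qed

text \<open>The number of root hyperplanes separating the alcove from the fundamental one: a floor
  \<open>m\<close> accounts for the indices \<open>k\<close> with \<open>1 \<le> k \<le> m\<close>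
  or \<open>m < k \<le> 0\<close>.\<close>

definition alcove_length :: "(complex \<Rightarrow> complex) \<Rightarrow> int" where
  "alcove_length w = (\<Sum>a\<in>pos_roots. \<bar>alcove_floor w a\<bar>)"

lemma alcove_length_eq:
  assumes "root_triple a b c"
  shows "alcove_length w = \<bar>alcove_floor w a\<bar> + \<bar>alcove_floor w b\<bar> + \<bar>alcove_floor w c\<bar>"
  using root_triple_distinct[OF assms] by (simp add: alcove_length_def pos_roots_eq[OF assms])

text \<open>The floor at \<open>a\<close> becomes \<open>-1\<close> minus itself, while the other
  two are exchanged and negated. Only the absolute value at \<open>a\<close> changes.\<close>

lemma alcove_length_simple:
  assumes "w \<in> affine_weyl" "a \<in> pos_roots"
  shows "alcove_length (bary_refl a 0 \<circ> w) = alcove_length w + (if alcove_floor w a < 0 then -1 else 1)"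
proof -
  obtain b c where t: "root_triple a b c" using obtain_root_triple[OF assms(2)] .
  show ?thesis
    unfolding alcove_length_eq[OF t] alcove_floor_refl[OF assms(1) t] by simp
qed

lemma alcove_floor_id: "a \<in> pos_roots \<Longrightarrow> alcove_floor id a = 0"
  by (simp add: alcove_floor_def bary_coord_alcove_center)

lemma alcove_length_id: "alcove_length id = 0"
  unfolding alcove_length_def by (intro sum.neutral) (simp add: alcove_floor_id)

lemma alcove_length_word:
  assumes "set ss \<subseteq> simple_reflections"
  shows "foldr (\<circ>) ss id \<in> affine_weyl \<and> alcove_length (foldr (\<circ>) ss id) \<le> int (length ss)"
  using assms
proof (induction ss)
  case Nil
  show ?case
    unfolding foldr_Nil id_apply[of id] alcove_length_id by (simp only: id_affine_weyl) simp
next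
  case (Cons s ss)
  then obtain a where a: "a \<in> pos_roots" and s: "s = bary_refl a 0" by (auto simp: simple_reflections_eq)
  have "set ss \<subseteq> simple_reflections" using Cons.prems by simp
  from Cons.IH[OF this] have w: "foldr (\<circ>) ss id \<in> affine_weyl" "alcove_length (foldr (\<circ>) ss id) \<le> int (length ss)"
    by blast+
  have f: "foldr (\<circ>) (s # ss) id = bary_refl a 0 \<circ> foldr (\<circ>) ss id" by (simp add: s)
  have "bary_refl a 0 \<circ> foldr (\<circ>) ss id \<in> affine_weyl \<and>
      alcove_length (bary_refl a 0 \<circ> foldr (\<circ>) ss id) \<le> int (length (s # ss))"
    using alcove_length_simple[OF w(1) a] w comp_affine_weyl[OF bary_refl_affine_weyl[OF a, of 0] w(1)]
    by (auto split: if_splits)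
  then show ?case by (simp only: f)
qed

lemma alcove_length_eq_word:
  assumes "w \<in> affine_weyl" "alcove_length w = int n"
  shows "\<exists>ss. set ss \<subseteq> simple_reflections \<and> length ss = n \<and> foldr (\<circ>) ss id = w"
  using assms
proof (induction n arbitrary: w)
  case 0
  have "finite pos_roots" by (simp add: pos_roots_def)
  then have "alcove_floor w a = 0" if "a \<in> pos_roots" for a
    using 0(2) that by (simp add: alcove_length_def sum_nonneg_eq_0_iff)
  then have "w = id"
    using 0(1) by (intro affine_weyl_eqI_floor id_affine_weyl) (simp_all add: alcove_floor_id)
  then show ?case by simp
next
  case (Suc n)
  note t = root_triple_std
  \<comment> \<open>The floors have sum at most \<open>0\<close> and do not all vanish, so one of
    them is negative. The corresponding simple reflection is a left descent.\<close>
  have "\<exists>a\<in>pos_roots. alcove_floor w a < 0"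
    using Suc(3) alcove_floor_sum(1)[OF Suc(2) t] unfolding alcove_length_eq[OF t] pos_roots_eq[OF t] by auto
  then obtain a where a: "a \<in> pos_roots" "alcove_floor w a < 0" by blast
  let ?s = "bary_refl a 0"
  have "?s \<circ> w \<in> affine_weyl" "alcove_length (?s \<circ> w) = int n"
    using alcove_length_simple[OF Suc(2) a(1)] a Suc(2,3) comp_affine_weyl bary_refl_affine_weyl by auto
  then obtain ss where ss: "set ss \<subseteq> simple_reflections" "length ss = n" "foldr (\<circ>) ss id = ?s \<circ> w"
    using Suc.IH by blast
  have "foldr (\<circ>) (?s # ss) id = (?s \<circ> ?s) \<circ> w" using ss(3) by (simp add: fun_eq_iff)
  then have w: "foldr (\<circ>) (?s # ss) id = w" using bary_refl_invol[OF a(1), of 0] by simp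
  have "?s \<in> simple_reflections" using a(1) by (auto simp: simple_reflections_eq)
  then show ?case using ss(1,2) by (intro exI[of _ "?s # ss"] conjI w) auto
qed

lemma weyl_length_eq:
  assumes "w \<in> affine_weyl"
  shows "int (weyl_length w) = alcove_length w"
proof -
  have nn: "alcove_length w = int (nat (alcove_length w))"
    by (simp add: alcove_length_def sum_nonneg)
  have "weyl_length w = nat (alcove_length w)"
    unfolding weyl_length_def
  proof (rule Least_equality)
    show "\<exists>ss. set ss \<subseteq> simple_reflections \<and> length ss = nat (alcove_length w) \<and> foldr (\<circ>) ss id = w"
      by (rule alcove_length_eq_word[OF assms nn])
  next
    fix n assume "\<exists>ss. set ss \<subseteq> simple_reflections \<and> length ss = n \<and> foldr (\<circ>) ss id = w"
    then obtain ss where "set ss \<subseteq> simple_reflections" "length ss = n" "foldr (\<circ>) ss id = w" by blast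
    then show "nat (alcove_length w) \<le> n" using alcove_length_word[of ss] by (metis nat_le_iff)
  qed
  with nn show ?thesis by simp
qed

section \<open>Chambers and hexagons\<close>

lemma bary_coord_segment: "bary a (p + t *\<^sub>R (y - p)) = (1 - t) * bary a p + t * bary a y"
  using bary_coord_affine[of a t p y] by (simp add: algebra_simps)

text \<open>The six chambers, one for each unordered pair of roots and each sign. The apex has both
  coordinates \<open>1\<close> if \<open>pos\<close> holds and both \<open>0\<close>
  otherwise.\<close>

definition sector :: "complex \<Rightarrow> complex \<Rightarrow> bool \<Rightarrow> complex set" where
  "sector a b pos = {v. if pos then bary a v > 1 \<and> bary b v > 1 else bary a v < 0 \<and> bary b v < 0}"

lemma sector_swap: "sector a b pos = sector b a pos"
  by (auto simp: sector_def)

lemma sector_eq_vimage: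
  "sector a b pos = {v. bary a v \<in> (if pos then {1<..} else {..<0})} \<inter> {v. bary b v \<in> (if pos then {1<..} else {..<0})}"
  by (auto simp: sector_def)

lemma convex_sector: "convex (sector a b pos)"
  unfolding sector_eq_vimage by (intro convex_Int convex_bary_coord) auto

lemma open_sector: "open (sector a b pos)"
  unfolding sector_eq_vimage by (intro open_Int open_bary_coord) auto

lemma sector_in_chambers:
  assumes t: "root_triple a b c"
  shows "sector a b pos \<in> chambers"
  unfolding chambers_def in_components_maximal
proof (intro conjI allI impI)
  let ?S = "- (\<Union>a\<in>pos_roots. fund_strip a)"
  obtain v where "bary a v = (if pos then 2 else -1)" "bary b v = (if pos then 2 else -1)"
    by (rule bary_coord_point_exists[OF t])
  then have "v \<in> sector a b pos" by (cases pos) (simp_all add: sector_def)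
  then show "sector a b pos \<noteq> {}" by blast
  show "sector a b pos \<subseteq> ?S"
  proof
    fix v assume "v \<in> sector a b pos"
    with bary_coord_sum[OF t, of v] show "v \<in> ?S"
      by (auto simp: sector_def fund_strip_eq pos_roots_eq[OF t] split: if_splits)
  qed
  show "connected (sector a b pos)" by (intro convex_connected convex_sector)
  fix D assume D: "D \<noteq> {} \<and> sector a b pos \<subseteq> D \<and> D \<subseteq> ?S \<and> connected D"
  let ?I = "if pos then {..<1} else {0<..} :: real set"
  \<comment> \<open>A point outside all strips that violates an inequality of the sector violates it
    by more than the width of a strip. Hence the rest of \<open>D\<close> is covered by an open set
    disjoint from the sector, and connectedness applies.\<close>
  let ?O = "{v. bary a v \<in> ?I} \<union> {v. bary b v \<in> ?I}"
  have "open ?O" by (intro open_Un open_bary_coord) auto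
  moreover have "sector a b pos \<inter> ?O \<inter> D = {}" by (auto simp: sector_def split: if_splits)
  moreover have "D \<subseteq> sector a b pos \<union> ?O"
  proof
    fix v assume "v \<in> D"
    with D have "v \<in> ?S" by blast
    then have "\<not> (0 \<le> bary a v \<and> bary a v \<le> 1)" "\<not> (0 \<le> bary b v \<and> bary b v \<le> 1)"
      by (simp_all add: fund_strip_eq pos_roots_eq[OF t])
    then show "v \<in> sector a b pos \<union> ?O" by (auto simp: sector_def)
  qed
  ultimately have "sector a b pos \<inter> D = {} \<or> ?O \<inter> D = {}"
    using D connectedD[of D "sector a b pos" ?O, OF _ open_sector] by blast
  with D \<open>sector a b pos \<noteq> {}\<close> \<open>D \<subseteq> sector a b pos \<union> ?O\<close> show "D = sector a b pos" by blast
qed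

lemma closure_sector:
  assumes t: "root_triple a b c"
  shows "closure (sector a b pos) = {v. if pos then bary a v \<ge> 1 \<and> bary b v \<ge> 1 else bary a v \<le> 0 \<and> bary b v \<le> 0}"
proof
  let ?I = "if pos then {1..} else {..0} :: real set"
  have e: "{v. if pos then bary a v \<ge> 1 \<and> bary b v \<ge> 1 else bary a v \<le> 0 \<and> bary b v \<le> 0} =
     {v. bary a v \<in> ?I} \<inter> {v. bary b v \<in> ?I}"
    by auto
  have "closed ({v. bary a v \<in> ?I} \<inter> {v. bary b v \<in> ?I})"
    by (intro closed_Int closed_bary_coord) auto
  then show "closure (sector a b pos) \<subseteq> {v. if pos then bary a v \<ge> 1 \<and> bary b v \<ge> 1 else bary a v \<le> 0 \<and> bary b v \<le> 0}"
    unfolding e by (intro closure_minimal) (auto simp: sector_def split: if_splits)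
  show "{v. if pos then bary a v \<ge> 1 \<and> bary b v \<ge> 1 else bary a v \<le> 0 \<and> bary b v \<le> 0} \<subseteq> closure (sector a b pos)"
  proof
    fix v assume v: "v \<in> {v. if pos then bary a v \<ge> 1 \<and> bary b v \<ge> 1 else bary a v \<le> 0 \<and> bary b v \<le> 0}"
    obtain q where q: "bary a q = (if pos then 2 else -1)" "bary b q = (if pos then 2 else -1)"
      by (rule bary_coord_point_exists[OF t])
    have gt: "(1 - s) * x + s * 2 > 1" if "x \<ge> 1" "0 < s" "s < 1" for s x :: real
    proof -
      have "(1 - s) * (x - 1) \<ge> 0" using that by (intro mult_nonneg_nonneg) auto
      with that show ?thesis by (simp add: algebra_simps)
    qed
    have lt: "(1 - s) * x + s * (-1) < 0" if "x \<le> 0" "0 < s" "s < 1" for s x :: real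
    proof -
      have "(1 - s) * x \<le> 0" using that by (intro mult_nonneg_nonpos) auto
      with that show ?thesis by simp
    qed
    show "v \<in> closure (sector a b pos)"
    proof (rule in_closure_segment)
      fix s :: real assume s: "0 < s" "s < 1"
      show "(1 - s) *\<^sub>R v + s *\<^sub>R q \<in> sector a b pos"
        using v q gt[OF _ s] lt[OF _ s] by (cases pos) (simp_all add: sector_def bary_coord_affine)
    qed
  qed
qed

lemma frontier_sector:
  assumes t: "root_triple a b c"
  shows "frontier (sector a b pos) = {v. (if pos then bary a v \<ge> 1 \<and> bary b v \<ge> 1 else bary a v \<le> 0 \<and> bary b v \<le> 0)
     \<and> v \<notin> sector a b pos}"
  by (auto simp: frontier_def closure_sector[OF t] interior_open[OF open_sector])

lemma wall_ray_sector:
  assumes t: "root_triple a b c" and i: "i = (if pos then 1 else 0)"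
    and p: "bary a p = of_int i" "bary b p = of_int i"
    and y: "bary a y = of_int i" "bary b y = (if pos then 2 else -1)"
  shows "wall_ray (sector a b pos) a (wall_index a i) p (y - p)"
  unfolding wall_ray_def
proof (intro conjI)
  have "bary b y \<noteq> bary b p" using p y i by simp
  then show "y - p \<noteq> 0" by auto
  have "v \<in> frontier (sector a b pos) \<inter> root_hyperplane a (wall_index a i) \<longleftrightarrow> v \<in> {p + t *\<^sub>R (y - p) |t. t \<ge> 0}" for v
  proof
    assume v: "v \<in> frontier (sector a b pos) \<inter> root_hyperplane a (wall_index a i)"
    \<comment> \<open>Along the ray the \<open>b\<close>-coordinate moves by one unit per unit of
      parameter, since \<open>y\<close> was placed one unit away from the apex.\<close>
    let ?t = "if pos then bary b v - 1 else - bary b v"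
    have "v = p + ?t *\<^sub>R (y - p)"
      using v p y i by (intro bary_coord_eqI[OF t]) (simp_all only: bary_coord_segment, auto simp: root_hyperplane_eq algebra_simps)
    moreover have "?t \<ge> 0" using v by (auto simp: frontier_sector[OF t] split: if_splits)
    ultimately show "v \<in> {p + t *\<^sub>R (y - p) |t. 0 \<le> t}" by blast
  next
    assume "v \<in> {p + t *\<^sub>R (y - p) |t. 0 \<le> t}"
    then obtain s where s: "s \<ge> 0" "v = p + s *\<^sub>R (y - p)" by blast
    have "bary a v = of_int i" "bary b v = of_int i + s * (if pos then 1 else -1)"
      using p y i unfolding s(2) bary_coord_segment by (auto simp: algebra_simps)
    with s(1) i show "v \<in> frontier (sector a b pos) \<inter> root_hyperplane a (wall_index a i)"
      unfolding frontier_sector[OF t] root_hyperplane_eq unfolding sector_def by (cases pos) simp_all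
  qed
  then show "frontier (sector a b pos) \<inter> root_hyperplane a (wall_index a i) = {p + t *\<^sub>R (y - p) |t. t \<ge> 0}"
    by blast
qed

text \<open>Seen from a point of the sector, the two walls lie on opposite sides, because the
  coordinates of the two directions enter \<open>cross2\<close> with opposite signs. Which wall is
  counterclockwise depends on the orientation of the triple, hence the disjunction.\<close>

lemma sector_walls_oriented:
  assumes t: "root_triple a b c" and i: "i = (if pos then 1 else 0)" and x: "x \<in> sector a b pos"
  shows "ccw_wall (sector a b pos) x a (wall_index a i) \<and> cw_wall (sector a b pos) x b (wall_index b i) \<or>
         ccw_wall (sector a b pos) x b (wall_index b i) \<and> cw_wall (sector a b pos) x a (wall_index a i)"
proof -
  obtain p where p: "bary a p = of_int i" "bary b p = of_int i" by (rule bary_coord_point_exists[OF t])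
  obtain y where y: "bary a y = of_int i" "bary b y = (if pos then 2 else -1)" by (rule bary_coord_point_exists[OF t])
  obtain z where z: "bary b z = of_int i" "bary a z = (if pos then 2 else -1)" by (rule bary_coord_point_exists[OF t])
  have ray: "wall_ray (sector a b pos) a (wall_index a i) p (y - p)"
    "wall_ray (sector a b pos) b (wall_index b i) p (z - p)"
    using wall_ray_sector[OF t i p y] wall_ray_sector[OF root_triple_perm(1)[OF t] i p(2,1) z]
    by (simp_all add: sector_swap[of b a])
  obtain \<kappa> where k: "\<kappa> \<noteq> 0" "\<And>p x y. cross2 (x - p) (y - p) =
     \<kappa> * ((bary a x - bary a p) * (bary b y - bary b p) - (bary b x - bary b p) * (bary a y - bary a p))"
    using cross2_bary_coord[OF t] by blast
  define s r where "s = (if pos then bary a x - 1 else - bary a x)" and "r = (if pos then bary b x - 1 else - bary b x)"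
  have sr: "s > 0" "r > 0" using x by (auto simp: s_def r_def sector_def split: if_splits)
  have c: "cross2 (x - p) (y - p) = \<kappa> * s" "cross2 (x - p) (z - p) = - (\<kappa> * r)"
    using i by (auto simp: k(2) p y z s_def r_def)
  show ?thesis
  proof (cases "\<kappa> > 0")
    case True
    with sr c have "cross2 (x - p) (y - p) > 0" "cross2 (x - p) (z - p) < 0" by simp_all
    with ray show ?thesis unfolding ccw_wall_def cw_wall_def by blast
  next
    case False
    with k(1) have "\<kappa> < 0" by simp
    with sr c have "cross2 (x - p) (y - p) < 0" "cross2 (x - p) (z - p) > 0" by (simp_all add: mult_neg_pos)
    with ray show ?thesis unfolding ccw_wall_def cw_wall_def by blast
  qed
qed

text \<open>A hyperplane of the third root with index \<open>0\<close> or \<open>1\<close> meets the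
  frontier at most in the apex, so it cannot contain a nondegenerate ray of it. For the other two
  roots the sector lies on one side of the strip, which fixes the index.\<close>

lemma wall_ray_sectorD:
  assumes t: "root_triple a b c" and i: "i = (if pos then 1 else 0)"
    and ray: "wall_ray (sector a b pos) x k p d" and x: "x \<in> pos_roots" and k: "k = 0 \<or> k = 1"
  shows "x = a \<and> k = wall_index a i \<or> x = b \<and> k = wall_index b i"
proof -
  define k' where "k' = wall_index x k"
  have k': "k = wall_index x k'" "k' = 0 \<or> k' = 1" using k by (auto simp: k'_def wall_index_def)
  have e: "frontier (sector a b pos) \<inter> root_hyperplane x k = {p + t *\<^sub>R d | t. t \<ge> 0}" and "d \<noteq> 0"
    using ray by (auto simp: wall_ray_def)
  have "p + 0 *\<^sub>R d \<in> frontier (sector a b pos) \<inter> root_hyperplane x k"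
    "p + 1 *\<^sub>R d \<in> frontier (sector a b pos) \<inter> root_hyperplane x k" unfolding e by (blast intro: zero_le_one order_refl)+
  then have f: "p \<in> frontier (sector a b pos)" "p + d \<in> frontier (sector a b pos)"
    and h: "bary x p = of_int k'" "bary x (p + d) = of_int k'"
    by (auto simp: root_hyperplane_eq k'_def)
  have "x \<noteq> c"
  proof
    assume "x = c"
    with f h k'(2) bary_coord_sum[OF t, of p] bary_coord_sum[OF t, of "p + d"]
    have "bary a p = 0 \<and> bary b p = 0 \<and> bary a (p + d) = 0 \<and> bary b (p + d) = 0"
      by (auto simp: frontier_sector[OF t] split: if_splits)
    then have "p = p + d" by (intro bary_coord_eqI[OF t]) simp_all
    with \<open>d \<noteq> 0\<close> show False by simp
  qed
  moreover have "k' = i" if "x = a \<or> x = b"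
    using that f(1) h(1) k'(2) i by (auto simp: frontier_sector[OF t] split: if_splits)
  ultimately show ?thesis using x k'(1) by (auto simp: pos_roots_eq[OF t])
qed

section \<open>Distances to hyperplanes and uniqueness of the hexagon data\<close>

lemma infdist_root_hyperplane:
  assumes "a \<in> pos_roots"
  shows "infdist x (root_hyperplane a k) = \<bar>bary a x - of_int (wall_index a k)\<bar> / sqrt 2"
proof -
  have aa: "a \<bullet> a = 2" using assms by (auto simp: pos_roots_def)
  then have na: "norm a = sqrt 2" by (simp add: norm_eq_sqrt_inner)
  have e: "\<bar>bary a x - of_int (wall_index a k)\<bar> = \<bar>a \<bullet> x - of_int k\<bar>"
    by (cases "a = alpha_tilde") (simp_all add: bary_def wall_index_def abs_minus_commute del: inner_alpha_tilde)
  define y where "y = x - ((a \<bullet> x - of_int k) / 2) *\<^sub>R a"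
  have y: "y \<in> root_hyperplane a k" by (simp add: y_def root_hyperplane_def inner_diff_right aa diff_divide_distrib)
  have "sqrt 2 * sqrt 2 = (2::real)" by simp
  then have d: "dist x y = \<bar>a \<bullet> x - of_int k\<bar> / sqrt 2" by (simp add: y_def dist_norm na field_simps)
  show ?thesis
  proof (rule antisym)
    show "infdist x (root_hyperplane a k) \<le> \<bar>bary a x - of_int (wall_index a k)\<bar> / sqrt 2"
      unfolding e using infdist_le[OF y, of x] d by simp
    have "\<bar>a \<bullet> x - of_int k\<bar> / sqrt 2 \<le> dist x z" if "z \<in> root_hyperplane a k" for z
    proof -
      have "a \<bullet> x - of_int k = a \<bullet> (x - z)" using that by (simp add: root_hyperplane_def inner_diff_right)
      then have "\<bar>a \<bullet> x - of_int k\<bar> \<le> sqrt 2 * dist x z"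
        using Cauchy_Schwarz_ineq2[of a "x - z"] by (simp add: na dist_norm)
      then show ?thesis by (simp add: field_simps)
    qed
    then show "\<bar>bary a x - of_int (wall_index a k)\<bar> / sqrt 2 \<le> infdist x (root_hyperplane a k)"
      unfolding e infdist_def using y by (auto intro!: cINF_greatest)
  qed
qed

text \<open>If both walls have index \<open>i = 1\<close>, the third coordinate is below
  \<open>-1\<close> and its nearer hyperplane has index \<open>0\<close>; if \<open>i = 0\<close>,
  it is above \<open>1\<close> and the nearer index is \<open>1\<close>. This explains
  \<open>1 - i\<close>.\<close>

definition hexagon_points :: "complex \<Rightarrow> complex \<Rightarrow> complex \<Rightarrow> int \<Rightarrow> complex \<Rightarrow> complex set" where
  "hexagon_points a b c i q = {q, bary_refl a i q, bary_refl c (1 - i) (bary_refl a i q), bary_refl c (1 - i) q,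
     bary_refl c (1 - i) (bary_refl b i q), bary_refl b i q}"

lemma hexagon_points_swap: "hexagon_points a b c i q = hexagon_points b a c i q"
  by (auto simp: hexagon_points_def)

lemma wall_index_diff: "wall_index a (1 - k) = 1 - wall_index a k"
  by (simp add: wall_index_def)

text \<open>The chamber is determined by the alcove it contains, its walls by
  \<open>wall_ray_sectorD\<close>, and the third hyperplane by the distances. The only open choice,
  which of \<open>a\<close> and \<open>b\<close> is the counterclockwise wall, does not change the
  set of vertices.\<close>

lemma hexagon_eq:
  assumes t: "root_triple a b c" and i: "i = (if pos then 1 else 0)"
    and w: "w ` fund_alcove \<subseteq> sector a b pos" "w alcove_center \<in> sector a b pos"
  shows "hexagon w = convex hull (hexagon_points a b c i (w alcove_center))"
proof -
  let ?q = "w alcove_center" and ?C = "sector a b pos"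
  have vert: "(\<lambda>u. u alcove_center) ` set (hexagon_vertices w a (wall_index a i) b (wall_index b i) c (wall_index c (1 - i)))
     = hexagon_points a b c i ?q" for a b
    by (simp add: hexagon_vertices_def hexagon_points_def Let_def bary_refl_def)
  have near: "infdist ?q (root_hyperplane c k) < infdist ?q (root_hyperplane c (1 - k)) \<longleftrightarrow> k = wall_index c (1 - i)"
    if k: "k = 0 \<or> k = 1" for k
  proof -
    have "bary c ?q < -1 \<and> pos \<or> bary c ?q > 1 \<and> \<not> pos"
      using w(2) bary_coord_sum[OF t, of ?q] by (auto simp: sector_def split: if_splits)
    moreover have "wall_index c k = 0 \<or> wall_index c k = 1" using k by (auto simp: wall_index_def)
    moreover have "k = wall_index c (1 - i) \<longleftrightarrow> wall_index c k = 1 - i" by (auto simp: wall_index_def)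
    moreover have "infdist ?q (root_hyperplane c k) < infdist ?q (root_hyperplane c (1 - k)) \<longleftrightarrow>
        \<bar>bary c ?q - of_int (wall_index c k)\<bar> < \<bar>bary c ?q - of_int (1 - wall_index c k)\<bar>"
      by (simp only: infdist_root_hyperplane[of c] pos_roots_eq[OF t] insertI1 insertI2 wall_index_diff divide_less_cancel) simp
    ultimately show ?thesis using i by auto
  qed
  have ki: "wall_index x i = 0 \<or> wall_index x i = 1" "wall_index x (1 - i) = 0 \<or> wall_index x (1 - i) = 1" for x
    using i by (auto simp: wall_index_def)
  have data: "hexagon_data w a' (wall_index a' i) b' (wall_index b' i) c (wall_index c (1 - i))"
    if "{a', b', c} = pos_roots" "ccw_wall ?C ?q a' (wall_index a' i)" "cw_wall ?C ?q b' (wall_index b' i)" for a' b'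
    unfolding hexagon_data_def using that near ki[of c] ki[of a'] ki[of b'] sector_in_chambers[OF t, of pos] w(1) by auto
  have "\<exists>a' i' b' j' c' k'. hexagon_data w a' i' b' j' c' k' \<and> convex hull (hexagon_points a b c i ?q) =
     convex hull ((\<lambda>u. u alcove_center) ` set (hexagon_vertices w a' i' b' j' c' k'))"
    using sector_walls_oriented[OF t i w(2)]
  proof (elim disjE conjE)
    assume "ccw_wall ?C ?q a (wall_index a i)" "cw_wall ?C ?q b (wall_index b i)"
    from data[OF _ this] vert[of a b] t show ?thesis unfolding root_triple_def by metis
  next
    assume "ccw_wall ?C ?q b (wall_index b i)" "cw_wall ?C ?q a (wall_index a i)"
    from data[OF _ this] vert[of b a] hexagon_points_swap[of a b] root_triple_perm(1)[OF t] show ?thesis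
      unfolding root_triple_def by metis
  qed
  moreover have "convex hull ((\<lambda>u. u alcove_center) ` set (hexagon_vertices w a' i' b' j' c' k')) =
      convex hull (hexagon_points a b c i ?q)" if h: "hexagon_data w a' i' b' j' c' k'" for a' i' b' j' c' k'
  proof -
    from h have t': "root_triple a' b' c'" and ks: "i' = 0 \<or> i' = 1" "j' = 0 \<or> j' = 1" "k' = 0 \<or> k' = 1"
      and near': "infdist ?q (root_hyperplane c' k') < infdist ?q (root_hyperplane c' (1 - k'))"
      unfolding hexagon_data_def root_triple_def by blast+
    from h obtain C where C: "C \<in> chambers" "w ` fund_alcove \<subseteq> C" "ccw_wall C ?q a' i'" "cw_wall C ?q b' j'"
      unfolding hexagon_data_def by blast
    have "fund_alcove \<noteq> {}"
      unfolding fund_alcove_eq[OF t]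
      by (auto simp: bary_coord_alcove_center pos_roots_eq[OF t] intro!: exI[of _ alcove_center])
    with C(2) w(1) have "C \<inter> ?C \<noteq> {}" by blast
    with C(1) sector_in_chambers[OF t, of pos] have "C = ?C"
      unfolding chambers_def using components_nonoverlap by blast
    with C(3,4) obtain p d p' d' where "wall_ray ?C a' i' p d" "wall_ray ?C b' j' p' d'"
      unfolding ccw_wall_def cw_wall_def by blast
    then have "a' = a \<and> i' = wall_index a i \<or> a' = b \<and> i' = wall_index b i"
      "b' = a \<and> j' = wall_index a i \<or> b' = b \<and> j' = wall_index b i"
      using wall_ray_sectorD[OF t i] ks by (auto simp: pos_roots_eq[OF t'])
    moreover have "c = a' \<or> c = b' \<or> c = c'"
      using root_triple_mem[OF t, of c] root_triple_mem[OF t', of c] by blast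
    ultimately have ab: "a' = a \<and> i' = wall_index a i \<and> b' = b \<and> j' = wall_index b i \<or>
        a' = b \<and> i' = wall_index b i \<and> b' = a \<and> j' = wall_index a i" and c: "c' = c"
      using root_triple_distinct[OF t] root_triple_distinct[OF t'] by blast+
    have k: "k' = wall_index c (1 - i)" using near near' ks(3) c by blast
    from ab show ?thesis
    proof (elim disjE conjE)
      assume "a' = a" "i' = wall_index a i" "b' = b" "j' = wall_index b i"
      then show ?thesis using vert[of a b] c k by (simp only:)
    next
      assume "a' = b" "i' = wall_index b i" "b' = a" "j' = wall_index a i"
      then show ?thesis using vert[of b a] c k hexagon_points_swap[of a b c] by (simp only:)
    qed
  qed
  ultimately show ?thesis
    unfolding hexagon_def by (intro the_equality) blast+
qed

section \<open>The hexagon inequalities\<close>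

text \<open>An alcove is encoded by the triple of integer parts of its coordinates, whose sum is \<open>0\<close> or \<open>-1\<close>.
  The difference of two coordinates is constant along the direction of the third root, so the hexagon is
  cut out by bounds on the three differences. Here \<open>(x, y, z)\<close> is the vertex \<open>w\<close>, and the chamber is given by
  \<open>x, y > 1\<close> if \<open>pos\<close> holds and by \<open>x, y < 0\<close> otherwise.\<close>

definition hex_ineq :: "bool \<Rightarrow> 'a::linordered_idom \<Rightarrow> 'a \<Rightarrow> 'a \<Rightarrow> 'a \<Rightarrow> 'a \<Rightarrow> 'a \<Rightarrow> bool" where
  "hex_ineq pos x y z m n h \<longleftrightarrow>
     (if pos then 1 - (x - z) \<le> n - h \<and> n - h \<le> y - z \<and> 1 - (y - z) \<le> m - h \<and> m - h \<le> x - z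
                \<and> 2 - (x - z) \<le> m - n \<and> m - n \<le> y - z - 2
      else y - z \<le> n - h \<and> n - h \<le> - (x - z) - 2 \<and> x - z \<le> m - h \<and> m - h \<le> - (y - z) - 2
                \<and> y - z + 1 \<le> m - n \<and> m - n \<le> - (x - z) - 1)"

text \<open>In terms of integer parts, the reflection in the \<open>k\<close>-th hyperplane of the first root is
  \<open>(m, n, h) \<mapsto> (2 * k - 1 - m, - h - k, - n - k)\<close>.\<close>

definition alcove_len :: "int \<Rightarrow> int \<Rightarrow> int \<Rightarrow> int" where
  "alcove_len m n h = \<bar>m\<bar> + \<bar>n\<bar> + \<bar>h\<bar>"

text \<open>The conclusion says that hyperplane \<open>k\<close> separates the alcove from the
  fundamental one; the hypothesis on \<open>k\<close> in \<open>len_incr\<close> is its exact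
  negation.\<close>

lemma len_decr:
  assumes "m + n + h = 0 \<or> m + n + h = -1"
    and "alcove_len (2*k-1-m) (-h-k) (-n-k) < alcove_len m n h"
  shows "1 \<le> k \<and> k \<le> m \<or> m < k \<and> k \<le> 0"
  using assms unfolding alcove_len_def by (smt (verit))

lemma len_incr:
  assumes "m + n + h = 0 \<or> m + n + h = -1"
    and "m < k \<and> 1 \<le> k \<or> k \<le> m \<and> k \<le> 0"
  shows "alcove_len (2*k-1-m) (-h-k) (-n-k) > alcove_len m n h"
  using assms unfolding alcove_len_def by (smt (verit))

lemma hex_ineq_swap: "hex_ineq pos x y z m n h = hex_ineq pos y x z n m (h :: 'a :: linordered_idom)"
  unfolding hex_ineq_def by (auto simp: algebra_simps)

text \<open>A chord of the hexagon in the direction of the first root has its midpoint at a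
  coordinate between \<open>0\<close> and \<open>1\<close>. A separating hyperplane with
  \<open>k \<ge> 1\<close> lies between that midpoint and the point, so the mirror image does not
  pass the other end of the chord; likewise for \<open>k \<le> 0\<close>.\<close>

lemma hex_down1:
  assumes "m + n + h = 0 \<or> m + n + h = -1"
    and "if pos then 1 \<le> x \<and> 1 \<le> y else x \<le> -1 \<and> y \<le> -1" "x + y + z = 0 \<or> x + y + z = (-1::int)"
    and "hex_ineq pos x y z m n h"
    and "1 \<le> k \<and> k \<le> m \<or> m < k \<and> k \<le> 0"
  shows "hex_ineq pos x y z (2*k-1-m) (-h-k) (-n-k)"
  using assms unfolding hex_ineq_def by (smt (verit))

lemma hex_down2:
  assumes "m + n + h = 0 \<or> m + n + h = -1"
    and "if pos then 1 \<le> x \<and> 1 \<le> y else x \<le> -1 \<and> y \<le> -1" "x + y + z = 0 \<or> x + y + z = (-1::int)"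
    and "hex_ineq pos x y z m n h"
    and "1 \<le> k \<and> k \<le> n \<or> n < k \<and> k \<le> 0"
  shows "hex_ineq pos x y z (-h-k) (2*k-1-n) (-m-k)"
proof -
  have "hex_ineq pos y x z (2*k-1-n) (-h-k) (-m-k)"
  proof (rule hex_down1)
    show "hex_ineq pos y x z n m h" using assms(4) by (simp add: hex_ineq_swap[of _ y])
  qed (use assms in \<open>auto split: if_splits\<close>)
  then show ?thesis by (simp add: hex_ineq_swap[of _ y])
qed

lemma hex_down3:
  assumes "m + n + h = 0 \<or> m + n + h = -1"
    and "if pos then 1 \<le> x \<and> 1 \<le> y else x \<le> -1 \<and> y \<le> -1" "x + y + z = 0 \<or> x + y + z = (-1::int)"
    and "hex_ineq pos x y z m n h"
    and "1 \<le> k \<and> k \<le> h \<or> h < k \<and> k \<le> 0"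
  shows "hex_ineq pos x y z  (-n-k) (-m-k) (2*k-1-h)"
  using assms unfolding hex_ineq_def by (smt (verit))



text \<open>This makes \<open>w\<close> longest in its hexagon and thus bounds the climb.\<close>

lemma hex_len_le:
  assumes "m + n + h = 0 \<or> m + n + h = -1"
    and "if pos then 1 \<le> x \<and> 1 \<le> y else x \<le> -1 \<and> y \<le> -1" "x + y + z = 0 \<or> x + y + z = (-1::int)"
    and "hex_ineq pos x y z m n h"
  shows "alcove_len m n h \<le> alcove_len x y z"
  using assms unfolding hex_ineq_def alcove_len_def by (smt (verit))

text \<open>If every upward reflection in a wall of the alcove of \<open>(m, n, h)\<close> leaves the hexagon, then the point is
  a vertex of the hexagon, and unless it is \<open>w\<close> one of the three reflections that produce the vertices moves it upwards.\<close>

lemma hex_up: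
  assumes p: "m + n + h = 0 \<or> m + n + h = -1"
    and w: "if pos then 1 \<le> x \<and> 1 \<le> y else x \<le> -1 \<and> y \<le> -1" "x + y + z = 0 \<or> x + y + z = (-1::int)"
    and hx: "hex_ineq pos x y z m n h"
    and ne: "(m,n,h) \<noteq> (x,y,z)"
  shows "\<exists>k. (m < k \<and> 1 \<le> k \<or> k \<le> m \<and> k \<le> 0) \<and> hex_ineq pos x y z (2*k-1-m) (-h-k) (-n-k) \<or>
     (n < k \<and> 1 \<le> k \<or> k \<le> n \<and> k \<le> 0) \<and> hex_ineq pos x y z (-h-k) (2*k-1-n) (-m-k) \<or>
     (h < k \<and> 1 \<le> k \<or> k \<le> h \<and> k \<le> 0) \<and> hex_ineq pos x y z (-n-k) (-m-k) (2*k-1-h)"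
proof (rule ccontr)
  assume A: "\<not> ?thesis"
  have A1: "\<not> hex_ineq pos x y z (2*k-1-m) (-h-k) (-n-k)" if "m < k \<and> 1 \<le> k \<or> k \<le> m \<and> k \<le> 0" for k
    using A that by blast
  have A2: "\<not> hex_ineq pos x y z (-h-k) (2*k-1-n) (-m-k)" if "n < k \<and> 1 \<le> k \<or> k \<le> n \<and> k \<le> 0" for k
    using A that by blast
  have A3: "\<not> hex_ineq pos x y z (-n-k) (-m-k) (2*k-1-h)" if "h < k \<and> 1 \<le> k \<or> k \<le> h \<and> k \<le> 0" for k
    using A that by blast
  \<comment> \<open>The indices \<open>m + 1\<close> and \<open>m\<close> are those of the two
    hyperplanes bounding the alcove in the first coordinate, and similarly for the others. The
    instances added in each case are the indices of the reflections producing the vertices: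
    \<open>1, 1, 0\<close> if \<open>pos\<close> holds and \<open>0, 0, 1\<close> otherwise.\<close>
  note facts = p w hx ne A1[of "m+1"] A1[of m] A2[of "n+1"] A2[of n] A3[of "h+1"] A3[of h]
  show False
  proof (cases pos)
    case True
    note f = facts[unfolded hex_ineq_def] A1[of 1, unfolded hex_ineq_def] A2[of 1, unfolded hex_ineq_def] A3[of 0, unfolded hex_ineq_def]
    show ?thesis using f[simplified True if_True simp_thms] by (smt (z3))
  next
    case False
    note f = facts[unfolded hex_ineq_def] A1[of 0, unfolded hex_ineq_def] A2[of 0, unfolded hex_ineq_def] A3[of 1, unfolded hex_ineq_def]
    show ?thesis using f[simplified False if_False simp_thms] by (smt (z3))
  qed
qed

section \<open>Bruhat intervals\<close>

lemma convex_bary_coord_diff: "convex S \<Longrightarrow> convex {v. bary a v - bary b v \<in> S}"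
proof -
  assume "convex S"
  moreover have "((1 - t) * x + t * y) - ((1 - t) * x' + t * y') = (1 - t) * (x - x') + t * (y - y')" for t x y x' y' :: real
    by (simp add: algebra_simps)
  ultimately show ?thesis by (simp add: convex_alt bary_coord_affine)
qed

lemma convex_hex_ineq: "convex {v. hex_ineq pos x y z (bary a v) (bary b v) (bary c v)}"
proof -
  have "{v. hex_ineq pos x y z (bary a v) (bary b v) (bary c v)} =
    {v. bary b v - bary c v \<in> (if pos then {1 - (x - z)..y - z} else {y - z..- (x - z) - 2})} \<inter>
    {v. bary a v - bary c v \<in> (if pos then {1 - (y - z)..x - z} else {x - z..- (y - z) - 2})} \<inter>
    {v. bary a v - bary b v \<in> (if pos then {2 - (x - z)..y - z - 2} else {y - z + 1..- (x - z) - 1})}"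
    by (auto simp: hex_ineq_def)
  then show ?thesis by (simp only:) (intro convex_Int convex_bary_coord_diff; simp)
qed

text \<open>The constants in \<open>hex_ineq\<close> come from these vertices: each bound is
  attained at two adjacent ones and so supports one edge. For example, \<open>n - h = y - z\<close>
  holds at \<open>q\<close> and at \<open>bary_refl a i q\<close> when \<open>pos\<close>
  holds.\<close>

lemma hexagon_points_hex_ineq:
  assumes t: "root_triple a b c" and i: "i = (if pos then 1 else 0)" and q: "q \<in> sector a b pos"
  shows "hexagon_points a b c i q \<subseteq> {v. hex_ineq pos (bary a q) (bary b q) (bary c q) (bary a v) (bary b v) (bary c v)}"
proof -
  note r = bary_coord_refl[OF t] bary_coord_refl[OF root_triple_perm(1)[OF t]] bary_coord_refl[OF root_triple_perm(2)[OF t]]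
    bary_coord_refl[OF root_triple_perm(3)[OF t]] bary_coord_refl[OF root_triple_perm(4)[OF t]] bary_coord_refl[OF root_triple_perm(5)[OF t]]
  have "bary c q = 1 - bary a q - bary b q" using bary_coord_sum[OF t, of q] by simp
  with q i show ?thesis
    by (auto simp: hexagon_points_def hex_ineq_def r sector_def)
qed

lemma convexD_affine:
  fixes S :: "'a :: real_vector set"
  assumes "convex S" "x \<in> S" "y \<in> S" "0 \<le> t" "t \<le> 1"
  shows "(1 - t) *\<^sub>R x + t *\<^sub>R y \<in> S"
  using assms by (simp add: convex_alt)

text \<open>The diagonal from \<open>q\<close> to its mirror image in the third wall cuts the hexagon into two trapezoids.
  A point of the trapezoid on the \<open>a\<close>-side lies on a chord parallel to that diagonal, whose end points
  \<open>L\<close> and \<open>R\<close> lie on the two legs.\<close>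

lemma hexagon_half:
  assumes t: "root_triple a b c" and i: "i = (if pos then 1 else 0)" and q: "q \<in> sector a b pos"
    and v: "hex_ineq pos (bary a q) (bary b q) (bary c q) (bary a v) (bary b v) (bary c v)"
    and side: "if pos then bary a v - bary b v \<le> bary a q - bary b q else bary a v - bary b v \<ge> bary a q - bary b q"
  shows "v \<in> convex hull (hexagon_points a b c i q)"
proof -
  let ?H = "convex hull (hexagon_points a b c i q)"
  define f where "f = bary a v - bary b v"
  \<comment> \<open>From \<open>q\<close> towards its image under \<open>bary_refl a i\<close>, the
    \<open>a\<close>-coordinate drops by \<open>2 * d\<close> while the other two rise by
    \<open>d\<close>. The difference of the first two drops by \<open>3 * d\<close>, and
    \<open>d\<close> is chosen so that it reaches the value \<open>f\<close> at
    \<open>v\<close>.\<close>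
  define d where "d = (bary a q - bary b q - f) / 3"
  define l where "l = d / (bary a q - of_int i)"
  have sq: "bary a q + bary b q + bary c q = 1" and sv: "bary a v + bary b v + bary c v = 1"
    using bary_coord_sum[OF t] by blast+
  have q': "if pos then bary a q > 1 \<and> bary b q > 1 else bary a q < 0 \<and> bary b q < 0"
    using q by (simp add: sector_def)
  have nz: "bary a q - of_int i \<noteq> 0" using q' i by (auto split: if_splits)
  then have ld: "l * (bary a q - of_int i) = d" by (simp add: l_def)
  have l: "0 \<le> l" "l \<le> 1"
  proof -
    have "if pos then 0 \<le> d \<and> d \<le> bary a q - 1 else bary a q \<le> d \<and> d \<le> 0"
      using v side sq unfolding d_def f_def hex_ineq_def by (auto split: if_splits)
    with q' i show "0 \<le> l" "l \<le> 1"
      unfolding l_def by (auto simp: field_simps split: if_splits)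
  qed
  define L where "L = (1 - l) *\<^sub>R q + l *\<^sub>R bary_refl a i q"
  \<comment> \<open>By affinity \<open>R\<close> is the image of \<open>L\<close> under
    \<open>bary_refl c (1 - i)\<close>, so the chord from \<open>L\<close> to \<open>R\<close> is
    parallel to the diagonal.\<close>
  define R where "R = (1 - l) *\<^sub>R bary_refl c (1 - i) q + l *\<^sub>R bary_refl c (1 - i) (bary_refl a i q)"
  have LR: "L \<in> ?H" "R \<in> ?H"
    unfolding L_def R_def
    by (intro convexD_affine[OF convex_convex_hull] l hull_inc; simp add: hexagon_points_def)+
  note r = bary_coord_refl[OF t] bary_coord_refl[OF root_triple_perm(1)[OF t]] bary_coord_refl[OF root_triple_perm(2)[OF t]]
    bary_coord_refl[OF root_triple_perm(3)[OF t]] bary_coord_refl[OF root_triple_perm(4)[OF t]] bary_coord_refl[OF root_triple_perm(5)[OF t]]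
  have aL: "bary a L = bary a q - 2 * d"
    unfolding L_def bary_coord_affine r ld[symmetric] by (simp add: algebra_simps)
  have bL: "bary b L = bary b q + d"
  proof -
    have "bary b (bary_refl a i q) = bary b q + (bary a q - of_int i)" using sq by (simp add: r)
    then show ?thesis by (simp only: L_def bary_coord_affine ld[symmetric]) (simp add: algebra_simps)
  qed
  have sL: "bary a L + bary b L + bary c L = 1" using bary_coord_sum[OF t] .
  have aR: "bary a R = of_int i - bary b L" and bR: "bary b R = of_int i - bary a L"
    unfolding R_def L_def bary_coord_affine by (simp_all add: r algebra_simps)
  have sR: "bary a R + bary b R + bary c R = 1" using bary_coord_sum[OF t] .
  \<comment> \<open>The change of the third coordinate along the chord. Its sign is that of
    \<open>pos\<close>, because \<open>L\<close> lies beyond the hyperplane in which it is reflected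
    to \<open>R\<close>.\<close>
  define D where "D = bary c R - bary c L"
  define m where "m = (bary c v - bary c L) / D"
  have m: "D \<noteq> 0" "0 \<le> m" "m \<le> 1"
  proof -
    have "if pos then 0 < D \<and> bary c L \<le> bary c v \<and> bary c v \<le> bary c R else D < 0 \<and> bary c L \<ge> bary c v \<and> bary c v \<ge> bary c R"
    proof -
      have cL: "bary c L = bary c q + d" and D: "D = 2 - 2 * of_int i - 2 * bary c L" "bary c R = D + bary c L"
        and d: "3 * d = bary a q - bary b q - (bary a v - bary b v)"
        using sq sL sR aL bL aR bR unfolding D_def by (linarith, linarith, linarith) (simp add: d_def f_def)
      show ?thesis
      proof (cases pos)
        case True
        then have "real_of_int i = 1" using i by simp
        moreover note v[unfolded hex_ineq_def, simplified True if_True] side[simplified True if_True]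
          q'[simplified True if_True] cL D d sq sv
        ultimately have "0 < D \<and> bary c L \<le> bary c v \<and> bary c v \<le> bary c R"
          by (elim conjE, intro conjI; linarith)
        then show ?thesis using True by simp
      next
        case False
        then have "real_of_int i = 0" using i by simp
        moreover note v[unfolded hex_ineq_def, simplified False if_False] side[simplified False if_False]
          q'[simplified False if_False] cL D d sq sv
        ultimately have "D < 0 \<and> bary c L \<ge> bary c v \<and> bary c v \<ge> bary c R"
          by (elim conjE, intro conjI; linarith)
        then show ?thesis using False by simp
      qed
    qed
    then show "D \<noteq> 0" "0 \<le> m" "m \<le> 1"
      unfolding m_def D_def by (auto simp: field_simps split: if_splits)
  qed
  define z where "z = (1 - m) *\<^sub>R L + m *\<^sub>R R"
  have "bary c z = bary c L + m * D"
    unfolding z_def bary_coord_affine D_def by (simp add: algebra_simps)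
  then have cz: "bary c z = bary c v" using m(1) by (simp add: m_def)
  have fL: "bary a L - bary b L = f" and fR: "bary a R - bary b R = f"
    using aL bL aR bR unfolding d_def by (simp_all add: field_simps)
  have "bary a z - bary b z = (1 - m) * (bary a L - bary b L) + m * (bary a R - bary b R)"
    unfolding z_def bary_coord_affine by (simp add: algebra_simps)
  then have "bary a z - bary b z = f" unfolding fL fR by (simp add: algebra_simps)
  with cz bary_coord_sum[OF t, of z] sv have "z = v"
    unfolding f_def by (intro bary_coord_eqI[OF t]) linarith+
  moreover have "z \<in> ?H" unfolding z_def by (intro convexD_affine[OF convex_convex_hull] LR m)
  ultimately show ?thesis by simp
qed

lemma hexagon_hull:
  assumes t: "root_triple a b c" and i: "i = (if pos then 1 else 0)" and q: "q \<in> sector a b pos"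
  shows "v \<in> convex hull (hexagon_points a b c i q) \<longleftrightarrow>
    hex_ineq pos (bary a q) (bary b q) (bary c q) (bary a v) (bary b v) (bary c v)"
proof
  assume "v \<in> convex hull (hexagon_points a b c i q)"
  moreover have "convex hull (hexagon_points a b c i q) \<subseteq> {v. hex_ineq pos (bary a q) (bary b q) (bary c q) (bary a v) (bary b v) (bary c v)}"
    by (intro hull_minimal hexagon_points_hex_ineq[OF t i q] convex_hex_ineq)
  ultimately show "hex_ineq pos (bary a q) (bary b q) (bary c q) (bary a v) (bary b v) (bary c v)" by blast
next
  assume v: "hex_ineq pos (bary a q) (bary b q) (bary c q) (bary a v) (bary b v) (bary c v)"
  show "v \<in> convex hull (hexagon_points a b c i q)"
  proof (cases "if pos then bary a v - bary b v \<le> bary a q - bary b q else bary a v - bary b v \<ge> bary a q - bary b q")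
    case True
    then show ?thesis by (rule hexagon_half[OF t i q v])
  next
    case False
    then have "if pos then bary b v - bary a v \<le> bary b q - bary a q else bary b v - bary a v \<ge> bary b q - bary a q"
      by (auto split: if_splits)
    from hexagon_half[OF root_triple_perm(1)[OF t] i _ _ this] q v show ?thesis
      by (simp add: sector_swap[of b a] hexagon_points_swap[of b a] hex_ineq_swap[of _ "bary b q"])
  qed
qed

lemma bary_coord_center_diff:
  assumes "w \<in> affine_weyl" "a \<in> pos_roots" "b \<in> pos_roots"
  shows "bary a (w alcove_center) - bary b (w alcove_center) = of_int (alcove_floor w a - alcove_floor w b)"
  using bary_coord_center_cases[OF assms(1)] assms(2,3) by (elim disjE) simp_all

text \<open>\<open>hex_ineq\<close> is polymorphic for this purpose: it involves only differences,
  and the common fractional part of the coordinates of a center cancels, even when \<open>w\<close>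
  and \<open>x\<close> have different fractional parts.\<close>

lemma hex_ineq_center:
  assumes t: "root_triple a b c" and w: "w \<in> affine_weyl" and x: "x \<in> affine_weyl"
  shows "hex_ineq pos (bary a (w alcove_center)) (bary b (w alcove_center)) (bary c (w alcove_center))
      (bary a (x alcove_center)) (bary b (x alcove_center)) (bary c (x alcove_center)) \<longleftrightarrow>
    hex_ineq pos (alcove_floor w a) (alcove_floor w b) (alcove_floor w c)
      (alcove_floor x a) (alcove_floor x b) (alcove_floor x c)"
proof -
  have m: "a \<in> pos_roots" "b \<in> pos_roots" "c \<in> pos_roots" by (simp_all add: pos_roots_eq[OF t])
  note d = bary_coord_center_diff[OF w m(1) m(3)] bary_coord_center_diff[OF w m(2) m(3)]
    bary_coord_center_diff[OF x m(1) m(3)] bary_coord_center_diff[OF x m(2) m(3)] bary_coord_center_diff[OF x m(1) m(2)]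
  show ?thesis
    unfolding hex_ineq_def d by (cases pos) (simp_all, linarith+)
qed

text \<open>A zero floor would put the alcove into a strip, and of three nonzero integers two have
  the same sign.\<close>

lemma nonspiral_sector:
  assumes w: "w \<in> affine_weyl" and ns: "\<not> spiral w"
  obtains a b c pos where "root_triple a b c"
    "if pos then 1 \<le> alcove_floor w a \<and> 1 \<le> alcove_floor w b else alcove_floor w a \<le> -1 \<and> alcove_floor w b \<le> -1"
proof -
  have nz: "alcove_floor w a \<noteq> 0" if "a \<in> pos_roots" for a
  proof
    assume "alcove_floor w a = 0"
    then have "w ` fund_alcove \<subseteq> fund_strip a"
      using that unfolding image_fund_alcove[OF w] fund_strip_eq by force
    with ns that show False by (auto simp: spiral_def)
  qed
  note t = root_triple_std and p = root_triple_perm[OF root_triple_std]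
  define m n h where "m = alcove_floor w alpha1" and "n = alcove_floor w alpha2" and "h = alcove_floor w alpha_tilde"
  have "m \<noteq> 0" "n \<noteq> 0" "h \<noteq> 0" "m + n + h \<in> {0, -1}"
    using nz alcove_floor_sum(1)[OF w t] by (auto simp: m_def n_def h_def pos_roots_def)
  then have "1 \<le> m \<and> 1 \<le> n \<or> 1 \<le> m \<and> 1 \<le> h \<or> 1 \<le> n \<and> 1 \<le> h \<or> m \<le> -1 \<and> n \<le> -1 \<or> m \<le> -1 \<and> h \<le> -1 \<or> n \<le> -1 \<and> h \<le> -1"
    by auto
  then show ?thesis
    using that[OF t, of True] that[OF t, of False] that[OF p(2), of True] that[OF p(2), of False]
      that[OF p(4), of True] that[OF p(4), of False] unfolding m_def n_def h_def by auto
qed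

lemma hexagon_center_iff:
  assumes w: "w \<in> affine_weyl" and x: "x \<in> affine_weyl" and t: "root_triple a b c"
    and fl: "if pos then 1 \<le> alcove_floor w a \<and> 1 \<le> alcove_floor w b else alcove_floor w a \<le> -1 \<and> alcove_floor w b \<le> -1"
  shows "x alcove_center \<in> hexagon w \<longleftrightarrow> hex_ineq pos (alcove_floor w a) (alcove_floor w b) (alcove_floor w c)
      (alcove_floor x a) (alcove_floor x b) (alcove_floor x c)"
proof -
  have sub: "w ` fund_alcove \<subseteq> sector a b pos"
  proof
    fix v assume "v \<in> w ` fund_alcove"
    then have v: "of_int (alcove_floor w a) < bary a v" "bary a v < of_int (alcove_floor w a) + 1"
      "of_int (alcove_floor w b) < bary b v" "bary b v < of_int (alcove_floor w b) + 1"
      unfolding image_fund_alcove[OF w] pos_roots_eq[OF t] by simp_all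
    show "v \<in> sector a b pos"
    proof (cases pos)
      case True
      then have "real_of_int (alcove_floor w a) \<ge> 1" "real_of_int (alcove_floor w b) \<ge> 1" using fl by simp_all
      with v True show ?thesis by (simp add: sector_def)
    next
      case False
      then have "real_of_int (alcove_floor w a) \<le> -1" "real_of_int (alcove_floor w b) \<le> -1"
        using fl by (simp_all only: if_False) linarith+
      with v False show ?thesis by (simp add: sector_def)
    qed
  qed
  have "alcove_center \<in> fund_alcove"
    unfolding fund_alcove_eq[OF t] by (simp add: bary_coord_alcove_center pos_roots_eq[OF t])
  with sub have q: "w alcove_center \<in> sector a b pos" by blast
  show ?thesis
    unfolding hexagon_eq[OF t refl sub q] hexagon_hull[OF t refl q] hex_ineq_center[OF t w x] ..
qed

section \<open>From integer triples to the Bruhat order\<close>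

abbreviation floors_in_hexagon where
  "floors_in_hexagon pos a b c w x \<equiv> hex_ineq pos (alcove_floor w a) (alcove_floor w b) (alcove_floor w c)
      (alcove_floor x a) (alcove_floor x b) (alcove_floor x c)"

lemma alcove_length_eq_len: "root_triple a b c \<Longrightarrow> alcove_length w = alcove_len (alcove_floor w a) (alcove_floor w b) (alcove_floor w c)"
  by (simp add: alcove_length_eq alcove_len_def)

lemma alcove_length_decr:
  assumes "w \<in> affine_weyl" "root_triple a b c" "alcove_length (bary_refl a k \<circ> w) < alcove_length w"
  shows "1 \<le> k \<and> k \<le> alcove_floor w a \<or> alcove_floor w a < k \<and> k \<le> 0"
  using assms(3) alcove_floor_sum(1)[OF assms(1,2)]
  unfolding alcove_length_eq_len[OF assms(2)] alcove_floor_refl[OF assms(1,2)] by (intro len_decr) auto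

lemma alcove_length_incr:
  assumes "w \<in> affine_weyl" "root_triple a b c" "alcove_floor w a < k \<and> 1 \<le> k \<or> k \<le> alcove_floor w a \<and> k \<le> 0"
  shows "alcove_length w < alcove_length (bary_refl a k \<circ> w)"
  using assms(3) alcove_floor_sum(1)[OF assms(1,2)]
  unfolding alcove_length_eq_len[OF assms(2)] alcove_floor_refl[OF assms(1,2)] by (intro len_incr) auto

lemma hexagon_down:
  assumes w: "w \<in> affine_weyl" and t: "root_triple a b c"
    and fl: "if pos then 1 \<le> alcove_floor w a \<and> 1 \<le> alcove_floor w b else alcove_floor w a \<le> -1 \<and> alcove_floor w b \<le> -1"
    and v: "v \<in> affine_weyl" "floors_in_hexagon pos a b c w v"
    and r: "x \<in> pos_roots" "alcove_length (bary_refl x k \<circ> v) < alcove_length v"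
  shows "floors_in_hexagon pos a b c w (bary_refl x k \<circ> v)"
proof -
  have sw: "alcove_floor w a + alcove_floor w b + alcove_floor w c = 0 \<or> alcove_floor w a + alcove_floor w b + alcove_floor w c = -1"
    using alcove_floor_sum(1)[OF w t] by simp
  have sv: "alcove_floor v a + alcove_floor v b + alcove_floor v c = 0 \<or> alcove_floor v a + alcove_floor v b + alcove_floor v c = -1"
    using alcove_floor_sum(1)[OF v(1) t] by simp
  note p = root_triple_perm[OF t]
  from r(1) consider "x = a" | "x = b" | "x = c" by (auto simp: pos_roots_eq[OF t])
  then show ?thesis
  proof cases
    case 1
    show ?thesis
      unfolding 1 alcove_floor_refl[OF v(1) t]
      using alcove_length_decr[OF v(1) t r(2)[unfolded 1]] by (rule hex_down1[OF sv fl sw v(2)])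
  next
    case 2
    show ?thesis
      unfolding 2 alcove_floor_refl[OF v(1) p(1)]
      using alcove_length_decr[OF v(1) p(1) r(2)[unfolded 2]] by (rule hex_down2[OF sv fl sw v(2)])
  next
    case 3
    show ?thesis
      unfolding 3 alcove_floor_refl[OF v(1) p(5)]
      using alcove_length_decr[OF v(1) p(5) r(2)[unfolded 3]] by (rule hex_down3[OF sv fl sw v(2)])
  qed
qed

lemma hexagon_up:
  assumes w: "w \<in> affine_weyl" and t: "root_triple a b c"
    and fl: "if pos then 1 \<le> alcove_floor w a \<and> 1 \<le> alcove_floor w b else alcove_floor w a \<le> -1 \<and> alcove_floor w b \<le> -1"
    and v: "v \<in> affine_weyl" "floors_in_hexagon pos a b c w v" and ne: "v \<noteq> w"
  obtains x k where "x \<in> pos_roots" "alcove_length v < alcove_length (bary_refl x k \<circ> v)"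
    "floors_in_hexagon pos a b c w (bary_refl x k \<circ> v)"
proof -
  have sw: "alcove_floor w a + alcove_floor w b + alcove_floor w c = 0 \<or> alcove_floor w a + alcove_floor w b + alcove_floor w c = -1"
    using alcove_floor_sum(1)[OF w t] by simp
  have sv: "alcove_floor v a + alcove_floor v b + alcove_floor v c = 0 \<or> alcove_floor v a + alcove_floor v b + alcove_floor v c = -1"
    using alcove_floor_sum(1)[OF v(1) t] by simp
  note p = root_triple_perm[OF t]
  have m: "a \<in> pos_roots" "b \<in> pos_roots" "c \<in> pos_roots" by (simp_all add: pos_roots_eq[OF t])
  have "(alcove_floor v a, alcove_floor v b, alcove_floor v c) \<noteq> (alcove_floor w a, alcove_floor w b, alcove_floor w c)"
    using ne affine_weyl_eqI_floor[OF v(1) w] by (auto simp: pos_roots_eq[OF t])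
  from hex_up[OF sv fl sw v(2) this] obtain k where
    "(alcove_floor v a < k \<and> 1 \<le> k \<or> k \<le> alcove_floor v a \<and> k \<le> 0) \<and> floors_in_hexagon pos a b c w (bary_refl a k \<circ> v) \<or>
     (alcove_floor v b < k \<and> 1 \<le> k \<or> k \<le> alcove_floor v b \<and> k \<le> 0) \<and> floors_in_hexagon pos a b c w (bary_refl b k \<circ> v) \<or>
     (alcove_floor v c < k \<and> 1 \<le> k \<or> k \<le> alcove_floor v c \<and> k \<le> 0) \<and> floors_in_hexagon pos a b c w (bary_refl c k \<circ> v)"
    unfolding alcove_floor_refl[OF v(1) t] alcove_floor_refl[OF v(1) p(1)] alcove_floor_refl[OF v(1) p(5)] by (elim exE)
  then show ?thesis
    using that[OF m(1) alcove_length_incr[OF v(1) t]] that[OF m(2) alcove_length_incr[OF v(1) p(1)]]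
      that[OF m(3) alcove_length_incr[OF v(1) p(5)]] by blast
qed

lemma bruhat_step_iff:
  "(u, v) \<in> bruhat_step \<longleftrightarrow> u \<in> affine_weyl \<and>
     (\<exists>a k. a \<in> pos_roots \<and> v = bary_refl a k \<circ> u \<and> alcove_length u < alcove_length v)"
proof -
  have "weyl_length u < weyl_length (bary_refl a k \<circ> u) \<longleftrightarrow> alcove_length u < alcove_length (bary_refl a k \<circ> u)"
    if "u \<in> affine_weyl" "a \<in> pos_roots" for a k
    using weyl_length_eq[OF that(1)] weyl_length_eq[OF comp_affine_weyl[OF bary_refl_affine_weyl[OF that(2), of k] that(1)]]
    by linarith
  then show ?thesis unfolding bruhat_step_def reflections_eq by blast
qed

theorem theorem4p1:
  fixes w :: "complex \<Rightarrow> complex"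
  assumes "w \<in> affine_weyl" and "\<not> spiral w"
  shows "{x \<in> affine_weyl. bruhat_le x w} = {x \<in> affine_weyl. x alcove_center \<in> hexagon w}"
proof -
  note w = assms(1)
  obtain a b c pos where t: "root_triple a b c" and
    fl: "if pos then 1 \<le> alcove_floor w a \<and> 1 \<le> alcove_floor w b else alcove_floor w a \<le> -1 \<and> alcove_floor w b \<le> -1"
    using nonspiral_sector[OF assms] by blast
  have sw: "alcove_floor w a + alcove_floor w b + alcove_floor w c = 0 \<or> alcove_floor w a + alcove_floor w b + alcove_floor w c = -1"
    using alcove_floor_sum(1)[OF w t] by simp
  have down: "x \<in> affine_weyl \<and> floors_in_hexagon pos a b c w x" if "(x, w) \<in> bruhat_step\<^sup>*" for x
    using that
  proof (induction rule: converse_rtrancl_induct)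
    case base
    show ?case using w fl sw by (auto simp: hex_ineq_def split: if_splits)
  next
    case (step u v)
    then obtain y k where u: "u \<in> affine_weyl" and y: "y \<in> pos_roots" "v = bary_refl y k \<circ> u" "alcove_length u < alcove_length v"
      unfolding bruhat_step_iff by blast
    \<comment> \<open>The step is read backwards: the same involution takes the longer
      \<open>v\<close> to the shorter \<open>u\<close>, so \<open>hexagon_down\<close>
      applies.\<close>
    have e: "u = bary_refl y k \<circ> v"
      unfolding y(2) o_assoc bary_refl_invol[OF y(1)] by simp
    have "floors_in_hexagon pos a b c w (bary_refl y k \<circ> v)"
      using step.IH y(3) unfolding e by (intro hexagon_down[OF w t fl _ _ y(1)]) blast+
    with u show ?case unfolding e by blast
  qed
  have up: "(x, w) \<in> bruhat_step\<^sup>*" if "x \<in> affine_weyl" "floors_in_hexagon pos a b c w x" for x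
    using that
  proof (induction "nat (alcove_length w - alcove_length x)" arbitrary: x rule: less_induct)
    case less
    show ?case
    proof (cases "x = w")
      case False
      from hexagon_up[OF w t fl less.prems this] obtain y k where y: "y \<in> pos_roots"
        "alcove_length x < alcove_length (bary_refl y k \<circ> x)" "floors_in_hexagon pos a b c w (bary_refl y k \<circ> x)"
        by blast
      let ?x = "bary_refl y k \<circ> x"
      have x: "?x \<in> affine_weyl" using y(1) less.prems(1) by (intro comp_affine_weyl bary_refl_affine_weyl)
      \<comment> \<open>The measure is truncated at \<open>0\<close> by \<open>nat\<close>, so a
        strict decrease needs the longer element to stay within the length of
        \<open>w\<close>.\<close>
      have "alcove_length ?x \<le> alcove_length w"
        unfolding alcove_length_eq_len[OF t] using alcove_floor_sum(1)[OF x t]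
        by (intro hex_len_le[OF _ fl sw y(3)]) simp
      then have "(?x, w) \<in> bruhat_step\<^sup>*" using y(2) by (intro less.hyps x y(3)) simp
      moreover have "(x, ?x) \<in> bruhat_step" unfolding bruhat_step_iff using less.prems(1) y(1,2) by blast
      ultimately show ?thesis by (rule converse_rtrancl_into_rtrancl[rotated])
    qed simp
  qed
  show ?thesis
    unfolding bruhat_le_def using hexagon_center_iff[OF w _ t fl] down up by blast
qed

end
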